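(* For $k<n/10$ and $\epsilon>0$, the property of being $(n-k)$-symmetric is testable with $O(\frac{k}{\epsilon}\log\frac{k}{\epsilon})$ queries: there is a randomized algorithm which, given query access to $f:\{0,1\}^n\to\{0,1\}$, makes $O(\frac{k}{\epsilon}\log\frac{k}{\epsilon})$ queries, accepts with probability at least $2/3$ if $f$ is $(n-k)$-symmetric, and rejects with probability at least $2/3$ if $f$ is $\epsilon$-far from every $(n-k)$-symmetric function.
   Context: For a permutation $\pi$ of $[n]$ and $x\in\{0,1\}^n$, $\pi x$ denotes the vector whose $\pi(i)$-th coordinate is $x_i$. For $J\subseteq[n]$, $\mathcal{S}_J$ is the set of permutations of $[n]$ fixing every element outside $J$. A function $f:\{0,1\}^n\to\{0,1\}$ is $J$-symmetric if $f(\pi x)=f(x)$ for all $x$ and all $\pi\in\mathcal{S}_J$, and $t$-symmetric if it is $J$-symmetric for some $J$ with $|J|\ge t$. The distance between functions is $\mathrm{dist}(f,g)=\Pr_x[f(x)\ne g(x)]$ with $x$ uniform in $\{0,1\}^n$; $f$ is $\epsilon$-far from a class if its distance to every member is at least $\epsilon$.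
   Formalization: The case k = 0 is excluded, since the bound (k/ε)log(k/ε) is then undefined (or zero, which is too few queries to test full symmetry); the query bound is read as a uniform constant times max(1, (k/ε)log(k/ε)). *)

theory Defs
  imports "HOL-Probability.Probability" "HOL-Combinatorics.Permutations"
begin

definition cube :: "nat \<Rightarrow> bool list set" where
  "cube n = {x. length x = n}"

text \<open>pi x: the vector whose pi(i)-th coordinate is x_i, i.e. (pi x)_j = x_{pi^{-1}(j)}.\<close>
definition perm_act :: "nat \<Rightarrow> (nat \<Rightarrow> nat) \<Rightarrow> bool list \<Rightarrow> bool list" where
  "perm_act n \<pi> x = map (\<lambda>j. x ! (inv \<pi> j)) [0..<n]"

definition J_symmetric :: "nat \<Rightarrow> nat set \<Rightarrow> (bool list \<Rightarrow> bool) \<Rightarrow> bool" where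
  "J_symmetric n J f \<longleftrightarrow>
     (\<forall>x\<in>cube n. \<forall>\<pi>. \<pi> permutes J \<longrightarrow> f (perm_act n \<pi> x) = f x)"

definition t_symmetric :: "nat \<Rightarrow> nat \<Rightarrow> (bool list \<Rightarrow> bool) \<Rightarrow> bool" where
  "t_symmetric n t f \<longleftrightarrow> (\<exists>J. J \<subseteq> {..<n} \<and> card J \<ge> t \<and> J_symmetric n J f)"

definition fdist :: "nat \<Rightarrow> (bool list \<Rightarrow> bool) \<Rightarrow> (bool list \<Rightarrow> bool) \<Rightarrow> real" where
  "fdist n f g = real (card {x\<in>cube n. f x \<noteq> g x}) / 2 ^ n"

definition far_from_t_symmetric :: "nat \<Rightarrow> nat \<Rightarrow> real \<Rightarrow> (bool list \<Rightarrow> bool) \<Rightarrow> bool" where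
  "far_from_t_symmetric n t eps f \<longleftrightarrow> (\<forall>g. t_symmetric n t g \<longrightarrow> fdist n f g \<ge> eps)"

text \<open>Deterministic adaptive query algorithms = decision trees; a randomized algorithm is
  a probability distribution over decision trees.\<close>
datatype qtree = Leaf bool | Query "bool list" "bool \<Rightarrow> qtree"

primrec run :: "(bool list \<Rightarrow> bool) \<Rightarrow> qtree \<Rightarrow> bool" where
  "run f (Leaf b) = b"
| "run f (Query x t) = run f (t (f x))"

primrec depth :: "qtree \<Rightarrow> nat" where
  "depth (Leaf b) = 0"
| "depth (Query x t) = Suc (max (depth (t True)) (depth (t False)))"

primrec queries_in :: "nat \<Rightarrow> qtree \<Rightarrow> bool" where
  "queries_in n (Leaf b) = True"
| "queries_in n (Query x t) = (x \<in> cube n \<and> queries_in n (t True) \<and> queries_in n (t False))"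

end

theory Submission
  imports Defs
begin

text \<open>
  For a permutation \<open>\<sigma>\<close> let \<open>s(\<sigma>)\<close> count the \<open>x\<close> with \<open>f (\<sigma> x) \<noteq> f x\<close>; then \<open>s(\<sigma> \<circ> \<tau>) \<le> s(\<sigma>) + s(\<tau>)\<close>.
  If \<open>D1\<close> and \<open>D2\<close> are not too large, a permutation fixing \<open>D1 \<inter> D2\<close> pointwise is a product of three
  permutations each of which fixes \<open>D1\<close> or \<open>D2\<close> pointwise, so if all permutations fixing \<open>D1\<close> and all those fixing \<open>D2\<close> have small \<open>s\<close>, so have
  those fixing \<open>D1 \<inter> D2\<close>.  Consequently, if \<open>f\<close> is far from \<open>(n - k)\<close>-symmetric, the sets \<open>D\<close> outside
  of which \<open>f\<close> is nearly symmetric intersect in many points, and after colouring the coordinates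
  randomly with \<open>O(k^2)\<close> colours, very likely no union of \<open>k\<close> colour classes contains such a \<open>D\<close>.

  The tester reserves a random workspace \<open>W\<close>, which misses the asymmetric coordinates with probability
  at least \<open>2/3\<close>, and cuts the other coordinates into \<open>O(k^3)\<close> small blocks that refine the colouring.
  It compares \<open>f(x)\<close> with \<open>f(\<pi> x)\<close> for random \<open>\<pi>\<close> fixing the blocks found so far; when they differ,
  it walks from \<open>x\<close> to \<open>\<pi> x\<close> changing one block and \<open>W\<close> at a time, and binary search along this walk
  yields a new block containing an asymmetric coordinate.  It rejects on finding more than \<open>k\<close> blocks.
\<close>

section \<open>Cross-intersecting families\<close>

text \<open>The inductive step for cross-intersecting families: the four numbers are measures of
  sections. If \<open>a1 * b1\<close> exceeds \<open>P\<close>, then \<open>a0 * b0\<close> is at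
  most \<open>P * P / (a1 * b1)\<close>, and a quadratic inequality in \<open>P\<close> and
  \<open>a1 * b1\<close> remains.\<close>

lemma two_point_product_bound:
  fixes p P a0 a1 b0 b1 :: real
  assumes p: "0 \<le> p" "p \<le> 1/4" and a: "0 \<le> a0" "a0 \<le> a1" and b: "0 \<le> b0" "b0 \<le> b1"
    and P: "a1 * b0 \<le> P" "a0 * b1 \<le> P" "p * (a1 * b1) \<le> P"
  shows "((1 - p) * a0 + p * a1) * ((1 - p) * b0 + p * b1) \<le> P"
proof (cases "a1 * b1 \<le> P")
  case True
  have "(1 - p) * a0 + p * a1 \<le> (1 - p) * a1 + p * a1"
    using p a by (intro add_right_mono mult_left_mono) auto
  moreover have "(1 - p) * b0 + p * b1 \<le> (1 - p) * b1 + p * b1"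
    using p b by (intro add_right_mono mult_left_mono) auto
  moreover have "0 \<le> (1 - p) * b0 + p * b1" using p b by (intro add_nonneg_nonneg mult_nonneg_nonneg) auto
  ultimately have "((1 - p) * a0 + p * a1) * ((1 - p) * b0 + p * b1)
      \<le> ((1 - p) * a1 + p * a1) * ((1 - p) * b1 + p * b1)"
    using p a by (intro mult_mono) (auto intro!: add_nonneg_nonneg mult_nonneg_nonneg)
  also have "\<dots> = a1 * b1" by (simp add: algebra_simps)
  finally have "((1 - p) * a0 + p * a1) * ((1 - p) * b0 + p * b1) \<le> a1 * b1" .
  then show ?thesis using True by linarith
next
  case False
  define Z where "Z = a1 * b1"
  have P0: "0 \<le> P" using P(1) a b by (meson mult_nonneg_nonneg order_trans)
  have Z: "Z > P" "Z > 0" using False P0 by (auto simp: Z_def)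
  have "a0 * b0 * Z = (a1 * b0) * (a0 * b1)" by (simp add: Z_def)
  also have "\<dots> \<le> P * P" using P P0 a b by (intro mult_mono) auto
  finally have ab: "a0 * b0 * Z \<le> P * P" .
  have "p * p * Z \<le> p * P" using P(3) p by (simp add: Z_def mult_left_mono mult.assoc)
  also have "\<dots> \<le> (1 - p)\<^sup>2 * P"
  proof (intro mult_right_mono P0)
    have "(3/4)\<^sup>2 \<le> (1 - p)\<^sup>2" using p by (intro power_mono) auto
    then show "p \<le> (1 - p)\<^sup>2" using p by (simp add: power2_eq_square)
  qed
  \<comment> \<open>The two sides of \<open>quad\<close> differ by exactly this product.\<close>
  finally have "(Z - P) * (p * p * Z - (1 - p)\<^sup>2 * P) \<le> 0"
    using Z by (intro mult_nonneg_nonpos) auto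
  then have quad: "(1 - p)\<^sup>2 * (P * P) + 2 * p * (1 - p) * P * Z + p\<^sup>2 * Z * Z \<le> P * Z"
    by (simp add: algebra_simps power2_eq_square)
  have "((1 - p) * a0 + p * a1) * ((1 - p) * b0 + p * b1) * Z
      = (1 - p)\<^sup>2 * (a0 * b0 * Z) + p * (1 - p) * Z * (a1 * b0 + a0 * b1) + p\<^sup>2 * Z * Z"
    by (simp add: algebra_simps power2_eq_square Z_def)
  also have "\<dots> \<le> (1 - p)\<^sup>2 * (P * P) + p * (1 - p) * Z * (P + P) + p\<^sup>2 * Z * Z"
    using ab P p Z by (intro add_mono mult_left_mono) auto
  also have "\<dots> \<le> P * Z" using quad by (simp add: algebra_simps)
  finally show ?thesis using Z by simp
qed

lemma prob_bind_pmf: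
  "measure_pmf.prob (bind_pmf M N) X = (\<integral>x. measure_pmf.prob (N x) X \<partial>measure_pmf M)"
proof -
  have "ennreal (measure_pmf.prob (bind_pmf M N) X) = (\<integral>\<^sup>+x. ennreal (measure_pmf.prob (N x) X) \<partial>measure_pmf M)"
    by (simp flip: measure_pmf.emeasure_eq_measure)
  also have "\<dots> = ennreal (\<integral>x. measure_pmf.prob (N x) X \<partial>measure_pmf M)"
    by (intro nn_integral_eq_integral measure_pmf.integrable_const_bound[where B=1]) auto
  finally show ?thesis by (simp add: integral_nonneg)
qed

lemma prob_Pi_pmf_insert_bool:
  assumes "finite V" "x \<notin> V"
  shows "measure_pmf.prob (Pi_pmf (insert x V) False (\<lambda>_. q)) \<A>
    = (1 - pmf q True) * measure_pmf.prob (Pi_pmf V False (\<lambda>_. q)) {f. f(x := False) \<in> \<A>}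
      + pmf q True * measure_pmf.prob (Pi_pmf V False (\<lambda>_. q)) {f. f(x := True) \<in> \<A>}"
proof -
  have q: "pmf q False = 1 - pmf q True" by (simp add: pmf_False_conv_True)
  have "measure_pmf.prob (Pi_pmf (insert x V) False (\<lambda>_. q)) \<A>
     = measure_pmf.prob (bind_pmf q (\<lambda>b. map_pmf (\<lambda>f. f(x := b)) (Pi_pmf V False (\<lambda>_. q)))) \<A>"
    using assms by (simp add: Pi_pmf_insert pair_pmf_def map_bind_pmf map_pmf_def bind_assoc_pmf bind_return_pmf)
  also have "\<dots> = (\<integral>b. measure_pmf.prob (Pi_pmf V False (\<lambda>_. q)) {f. f(x := b) \<in> \<A>} \<partial>measure_pmf q)"
    by (simp add: prob_bind_pmf vimage_def)
  also have "\<dots> = (\<Sum>b\<in>UNIV. pmf q b * measure_pmf.prob (Pi_pmf V False (\<lambda>_. q)) {f. f(x := b) \<in> \<A>})"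
    by (subst integral_measure_pmf[of UNIV]) (auto simp: mult.commute)
  finally show ?thesis by (simp add: UNIV_bool q)
qed

text \<open>Induction on \<open>V\<close>, conditioning on one coordinate \<open>x\<close>. Sections
  keep meeting in \<open>t\<close> points, except that the two sections at \<open>True\<close> may
  lose \<open>x\<close> and then meet in \<open>t - 1\<close>; the extra factor
  \<open>pmf q True\<close> compensates for this.\<close>

lemma cross_intersecting_measure:
  fixes q :: "bool pmf"
  assumes "finite V" "pmf q True \<le> 1/4"
    and "\<And>f g. f \<in> \<A> \<Longrightarrow> g \<in> \<B> \<Longrightarrow> t \<le> card {v\<in>V. f v \<and> g v}"
  shows "measure_pmf.prob (Pi_pmf V False (\<lambda>_. q)) \<A> * measure_pmf.prob (Pi_pmf V False (\<lambda>_. q)) \<B>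
    \<le> pmf q True ^ t"
  using assms(1,3)
proof (induction V arbitrary: t \<A> \<B> rule: finite_induct)
  case empty
  show ?case
  proof (cases "t = 0")
    case True
    then show ?thesis by (simp add: mult_le_one)
  next
    case False
    then have "\<A> = {} \<or> \<B> = {}" using empty by fastforce
    then show ?thesis by auto
  qed
next
  case (insert x V)
  let ?p = "pmf q True"
  define \<mu> where "\<mu> = measure_pmf.prob (Pi_pmf V False (\<lambda>_. q))"
  define s where "s \<A> b = {f. f(x := b) \<in> \<A>}" for \<A> :: "('a \<Rightarrow> bool) set" and b
  have \<mu>0: "\<mu> X \<ge> 0" and \<mu>1: "\<mu> X \<le> 1" for X by (auto simp: \<mu>_def)
  have cross: "\<mu> (s \<A> a) * \<mu> (s \<B> b) \<le> ?p ^ t'" if "t' + of_bool (a \<and> b) \<le> t" for a b t'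
    unfolding \<mu>_def
  proof (rule insert.IH)
    fix f g assume "f \<in> s \<A> a" "g \<in> s \<B> b"
    then have "t \<le> card {v\<in>insert x V. (f(x:=a)) v \<and> (g(x:=b)) v}"
      using insert.prems[of "f(x:=a)" "g(x:=b)"] unfolding s_def by blast
    also have "{v\<in>insert x V. (f(x:=a)) v \<and> (g(x:=b)) v}
        = (if a \<and> b then {x} else {}) \<union> {v\<in>V. f v \<and> g v}"
      using insert.hyps by auto
    also have "card \<dots> = of_bool (a \<and> b) + card {v\<in>V. f v \<and> g v}"
      using insert.hyps by simp
    finally show "t' \<le> card {v\<in>V. f v \<and> g v}" using that by (cases "a \<and> b") auto
  qed
  define a0 a1 b0 b1 where "a0 = \<mu> (s \<A> False)" and "a1 = \<mu> (s \<A> True)"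
    and "b0 = \<mu> (s \<B> False)" and "b1 = \<mu> (s \<B> True)"
  have nn: "0 \<le> a0" "0 \<le> a1" "0 \<le> b0" "0 \<le> b1" "a1 \<le> 1" "b1 \<le> 1"
    by (auto simp: a0_def a1_def b0_def b1_def \<mu>0 \<mu>1)
  have c: "a0 * b0 \<le> ?p ^ t" "a0 * b1 \<le> ?p ^ t" "a1 * b0 \<le> ?p ^ t"
    using cross[of t] by (auto simp: a0_def a1_def b0_def b1_def)
  have c11: "?p * (a1 * b1) \<le> ?p ^ t"
  proof (cases t)
    case 0
    then show ?thesis using nn by (simp add: mult_le_one pmf_le_1)
  next
    case (Suc t')
    then have "a1 * b1 \<le> ?p ^ t'" using cross[of t' True True] by (simp add: a1_def b1_def)
    then show ?thesis by (simp add: Suc mult_left_mono)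
  qed
  have convex: "(1 - ?p) * u + ?p * v \<le> w" if "u \<le> w" "v \<le> w" for u v w :: real
    using convex_bound_le[OF that, of "1 - ?p" ?p] by (simp add: pmf_le_1)
  have "((1 - ?p) * a0 + ?p * a1) * ((1 - ?p) * b0 + ?p * b1) \<le> ?p ^ t"
  proof -
    \<comment> \<open>The families need not be monotone: when a section at \<open>True\<close> is
      the smaller one, the average is simply bounded by the section at \<open>False\<close>.\<close>
    consider "a1 \<le> a0" | "b1 \<le> b0" | "a0 \<le> a1" "b0 \<le> b1" by linarith
    then show ?thesis
    proof cases
      case 1
      have "((1 - ?p) * a0 + ?p * a1) * ((1 - ?p) * b0 + ?p * b1) \<le> a0 * ((1 - ?p) * b0 + ?p * b1)"
        using 1 nn by (intro mult_right_mono convex) (auto simp: pmf_le_1)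
      also have "\<dots> = (1 - ?p) * (a0 * b0) + ?p * (a0 * b1)" by (simp add: algebra_simps)
      also have "\<dots> \<le> ?p ^ t" using c by (intro convex)
      finally show ?thesis .
    next
      case 2
      have "((1 - ?p) * a0 + ?p * a1) * ((1 - ?p) * b0 + ?p * b1) \<le> ((1 - ?p) * a0 + ?p * a1) * b0"
        using 2 nn by (intro mult_left_mono convex) (auto simp: pmf_le_1)
      also have "\<dots> = (1 - ?p) * (a0 * b0) + ?p * (a1 * b0)" by (simp add: algebra_simps)
      also have "\<dots> \<le> ?p ^ t" using c by (intro convex)
      finally show ?thesis .
    next
      case 3
      then show ?thesis using c c11 nn assms(2) by (intro two_point_product_bound) auto
    qed
  qed
  then show ?case
    using insert.hyps
    by (simp add: prob_Pi_pmf_insert_bool a0_def a1_def b0_def b1_def \<mu>_def s_def)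
qed

section \<open>Sensitivity to permutations\<close>

lemma permutation_extending_inj:
  assumes "finite J" "A \<subseteq> J" "inj_on u A" "u ` A \<subseteq> J"
  obtains \<pi> where "\<pi> permutes J" "\<And>a. a \<in> A \<Longrightarrow> \<pi> a = u a"
proof -
  have "card (J - A) = card (J - u ` A)"
    using assms by (simp add: card_Diff_subset finite_subset card_image)
  then obtain v where v: "bij_betw v (J - A) (J - u ` A)"
    using assms(1) by (meson finite_Diff finite_same_card_bij)
  define \<pi> where "\<pi> x = (if x \<in> A then u x else if x \<in> J then v x else x)" for x
  have "bij_betw \<pi> A (u ` A)" using assms(3) by (auto simp: bij_betw_def \<pi>_def inj_on_def)
  moreover have "bij_betw \<pi> (J - A) (J - u ` A)"
    using v by (subst bij_betw_cong[of _ \<pi> v]) (auto simp: \<pi>_def)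
  ultimately have "bij_betw \<pi> (A \<union> (J - A)) (u ` A \<union> (J - u ` A))"
    by (rule bij_betw_combine) auto
  moreover have "A \<union> (J - A) = J" "u ` A \<union> (J - u ` A) = J" using assms by auto
  ultimately have "bij_betw \<pi> J J" by simp
  then have "\<pi> permutes J" by (rule bij_imp_permutes) (use assms in \<open>auto simp: \<pi>_def\<close>)
  moreover have "\<pi> a = u a" if "a \<in> A" for a using that by (simp add: \<pi>_def)
  ultimately show thesis using that by blast
qed

text \<open>A rewriting step prescribes only the sets before and after it; this realises it by a
  permutation.\<close>

lemma permutation_mapping_set:
  assumes "finite J" "finite X" "finite Y" "card X = card Y" "X - J = Y - J"
  obtains \<pi> where "\<pi> permutes J" "\<pi> ` X = Y"
proof -
  have "card (X \<inter> J) + card (X - J) = card (Y \<inter> J) + card (Y - J)"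
    using assms card_Int_Diff[of X J] card_Int_Diff[of Y J] by simp
  then have "card (X \<inter> J) = card (Y \<inter> J)" using assms(5) by simp
  then obtain u where u: "bij_betw u (X \<inter> J) (Y \<inter> J)"
    using assms by (meson finite_Int finite_same_card_bij)
  obtain \<pi> where \<pi>: "\<pi> permutes J" "\<And>a. a \<in> X \<inter> J \<Longrightarrow> \<pi> a = u a"
    using permutation_extending_inj[of J "X \<inter> J" u] u assms(1) by (auto simp: bij_betw_def)
  have "\<pi> ` (X \<inter> J) = Y \<inter> J" using u \<pi>(2) by (auto simp: bij_betw_def)
  moreover have "\<pi> ` (X - J) = X - J" using \<pi>(1) by (force simp: permutes_def image_iff)
  ultimately have "\<pi> ` ((X \<inter> J) \<union> (X - J)) = (Y \<inter> J) \<union> (Y - J)"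
    using assms(5) by (simp only: image_Un)
  moreover have "(X \<inter> J) \<union> (X - J) = X" "(Y \<inter> J) \<union> (Y - J) = Y" by auto
  ultimately show thesis using that \<pi>(1) by simp
qed

text \<open>With room for \<open>D2 - D1\<close> outside \<open>D1 \<union> D2\<close>, enough points of \<open>V - D2\<close> are sent by \<open>\<sigma>\<close> into
  \<open>V - D2\<close> to move all of \<open>D1 - D2\<close> out of the way.\<close>
lemma permutes_double_coset:
  assumes "finite V" "\<sigma> permutes (V - D1 \<inter> D2)"
    and D: "D1 \<subseteq> V" "D2 \<subseteq> V" and room: "card (D2 - D1) \<le> card (V - (D1 \<union> D2))"
  obtains \<tau> \<pi> \<tau>' where "\<tau> permutes (V - D2)" "\<pi> permutes (V - D1)" "\<tau>' permutes (V - D2)"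
    "\<sigma> = \<tau> \<circ> \<pi> \<circ> \<tau>'"
proof -
  let ?A = "D1 - D2" and ?B = "D2 - D1" and ?Y = "V - D2" and ?U = "V - D1 \<inter> D2"
  have fin: "finite D1" "finite D2" using assms finite_subset by auto
  define G where "G = {y\<in>?Y. \<sigma> y \<in> ?Y}"
  have inj: "inj \<sigma>" using assms(2) permutes_inj by blast
  have in_U: "\<sigma> y \<in> ?U" if "y \<in> ?U" for y using permutes_in_image[OF assms(2)] that by blast
  \<comment> \<open>A point of \<open>V - D2\<close> that \<open>\<sigma>\<close> moves out of
    \<open>V - D2\<close> lands in \<open>D2\<close>, but not in
    \<open>D1 \<inter> D2\<close>.\<close>
  have "card (?Y - G) \<le> card ?B"
  proof (rule card_inj_on_le[of \<sigma>])
    show "\<sigma> ` (?Y - G) \<subseteq> ?B" using in_U by (auto simp: G_def)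
  qed (use fin inj in \<open>auto simp: inj_on_def inj_def\<close>)
  moreover have "card ?Y = card G + card (?Y - G)"
  proof -
    have "G \<subseteq> ?Y" by (auto simp: G_def)
    then have "?Y \<inter> G = G" by blast
    then show ?thesis using assms(1) card_Int_Diff[of ?Y G] by simp
  qed
  moreover have "card ?Y = card (V - (D1 \<union> D2)) + card ?A"
    using assms(1) fin D
    by (subst card_Un_disjoint[symmetric]) (auto intro!: arg_cong[of _ _ card])
  ultimately have "card ?A \<le> card G" using room by linarith
  then obtain u where u: "inj_on u ?A" "u ` ?A \<subseteq> G"
    using fin assms(1) card_le_inj[of ?A G] by (auto simp: G_def)
  obtain \<alpha> where \<alpha>: "\<alpha> permutes ?Y" "\<And>a. a \<in> ?A \<Longrightarrow> \<alpha> a = u a"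
    using permutation_extending_inj[of ?Y ?A u] u assms(1) D by (auto simp: G_def)
  obtain \<tau> where \<tau>: "\<tau> permutes ?Y" "\<And>a. a \<in> ?A \<Longrightarrow> \<tau> a = \<sigma> (u a)"
  proof (rule permutation_extending_inj[of ?Y ?A "\<sigma> \<circ> u"])
    show "inj_on (\<sigma> \<circ> u) ?A" using u(1) inj by (auto simp: inj_on_def inj_def)
  qed (use u(2) assms(1) D in \<open>auto simp: G_def\<close>)
  \<comment> \<open>As \<open>\<tau>\<close> and \<open>\<sigma> \<circ> \<alpha>\<close> agree on
    \<open>D1 - D2\<close>, this quotient fixes \<open>D1 - D2\<close>, hence all of
    \<open>D1\<close>.\<close>
  define \<pi> where "\<pi> = inv \<tau> \<circ> \<sigma> \<circ> \<alpha>"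
  have "\<alpha> permutes ?U" "inv \<tau> permutes ?U"
    using \<alpha>(1) \<tau>(1) by (auto intro: permutes_subset permutes_inv)
  then have "\<pi> permutes ?U" unfolding \<pi>_def
    using assms(2) by (intro permutes_compose)
  moreover have "\<pi> a = a" if "a \<in> ?U - (V - D1)" for a
  proof -
    have "a \<in> ?A" using that by auto
    then have "\<sigma> (\<alpha> a) = \<tau> a" using \<alpha>(2) \<tau>(2) by simp
    then show ?thesis using permutes_inverses(2)[OF \<tau>(1)] by (simp add: \<pi>_def)
  qed
  ultimately have "\<pi> permutes (V - D1)" by (rule permutes_superset)
  moreover have "\<sigma> = \<tau> \<circ> \<pi> \<circ> inv \<alpha>"
    using permutes_inverses(1)[OF \<tau>(1)] permutes_inverses(1)[OF \<alpha>(1)]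
    by (auto simp: \<pi>_def fun_eq_iff)
  ultimately show thesis using that[of \<tau> \<pi> "inv \<alpha>"] \<tau>(1) permutes_inv[OF \<alpha>(1)] by blast
qed

text \<open>An input is represented by the set of its one-coordinates, so that a permutation acts by
  taking images.\<close>

definition sensitivity :: "nat \<Rightarrow> (nat set \<Rightarrow> bool) \<Rightarrow> (nat \<Rightarrow> nat) \<Rightarrow> nat" where
  "sensitivity n F \<sigma> = card {X\<in>Pow {..<n}. F (\<sigma> ` X) \<noteq> F X}"

lemma sensitivity_compose:
  assumes "\<tau> permutes {..<n}"
  shows "sensitivity n F (\<sigma> \<circ> \<tau>) \<le> sensitivity n F \<sigma> + sensitivity n F \<tau>"
proof -
  let ?S = "{X\<in>Pow {..<n}. F (\<sigma> ` X) \<noteq> F X}" and ?T = "{X\<in>Pow {..<n}. F (\<tau> ` X) \<noteq> F X}"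
  let ?S' = "{X\<in>Pow {..<n}. F (\<sigma> ` \<tau> ` X) \<noteq> F (\<tau> ` X)}"
  have inj: "inj_on ((`) \<tau>) (Pow {..<n})"
    using permutes_inj[OF assms] by (meson inj_on_image_Pow inj_on_subset subset_UNIV)
  have "card ?S' \<le> card ?S"
  proof (rule card_inj_on_le[of "(`) \<tau>"])
    show "inj_on ((`) \<tau>) ?S'" by (rule inj_on_subset[OF inj]) auto
    show "(`) \<tau> ` ?S' \<subseteq> ?S" using permutes_image[OF assms] by fastforce
  qed auto
  moreover have "card {X\<in>Pow {..<n}. F ((\<sigma> \<circ> \<tau>) ` X) \<noteq> F X} \<le> card (?S' \<union> ?T)"
    by (rule card_mono) (auto simp: image_comp)
  moreover have "card (?S' \<union> ?T) \<le> card ?S' + card ?T" by (rule card_Un_le)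
  ultimately show ?thesis unfolding sensitivity_def by linarith
qed

lemma sensitivity_intersection:
  assumes "\<sigma> permutes ({..<n} - D1 \<inter> D2)" "D1 \<subseteq> {..<n}" "D2 \<subseteq> {..<n}"
    and "card (D2 - D1) \<le> card ({..<n} - (D1 \<union> D2))"
    and 1: "\<And>\<pi>. \<pi> permutes ({..<n} - D1) \<Longrightarrow> real (sensitivity n F \<pi>) < \<delta>"
    and 2: "\<And>\<pi>. \<pi> permutes ({..<n} - D2) \<Longrightarrow> real (sensitivity n F \<pi>) < \<delta>"
  shows "real (sensitivity n F \<sigma>) < 3 * \<delta>"
proof -
  obtain \<tau> \<pi> \<tau>' where p: "\<tau> permutes ({..<n} - D2)" "\<pi> permutes ({..<n} - D1)"
    "\<tau>' permutes ({..<n} - D2)" and \<sigma>: "\<sigma> = \<tau> \<circ> \<pi> \<circ> \<tau>'"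
    using permutes_double_coset[OF _ assms(1-4)] by auto
  have "\<tau>' permutes {..<n}" "\<pi> permutes {..<n}" using p by (auto intro: permutes_subset)
  then have "sensitivity n F \<sigma> \<le> sensitivity n F \<tau> + sensitivity n F \<pi> + sensitivity n F \<tau>'"
    unfolding \<sigma> using sensitivity_compose by (meson add_le_mono1 order_trans)
  then show ?thesis using 1[OF p(2)] 2[OF p(1)] 2[OF p(3)] by linarith
qed

text \<open>Write \<open>\<sigma>\<close> as
  \<open>(\<sigma> \<circ> \<pi>) \<circ> inv \<pi>\<close> and average over \<open>\<pi>\<close>:
  both factors then range uniformly over the permutations of \<open>J\<close>.\<close>

lemma sensitivity_le_average:
  assumes "J \<subseteq> {..<n}" "\<sigma> permutes J"
  shows "sensitivity n F \<sigma> * card {\<pi>. \<pi> permutes J} \<le> 2 * (\<Sum>\<pi> | \<pi> permutes J. sensitivity n F \<pi>)"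
proof -
  let ?S = "{\<pi>. \<pi> permutes J}"
  have "(\<Sum>\<pi>\<in>?S. sensitivity n F \<sigma>) \<le> (\<Sum>\<pi>\<in>?S. sensitivity n F (\<sigma> \<circ> \<pi>) + sensitivity n F (inv \<pi>))"
  proof (rule sum_mono)
    fix \<pi> assume "\<pi> \<in> ?S"
    then have \<pi>: "\<pi> permutes J" by simp
    then have "inv \<pi> permutes {..<n}" using assms(1) by (meson permutes_inv permutes_subset)
    moreover have "\<sigma> = (\<sigma> \<circ> \<pi>) \<circ> inv \<pi>" using permutes_inverses(1)[OF \<pi>] by (auto simp: fun_eq_iff)
    ultimately show "sensitivity n F \<sigma> \<le> sensitivity n F (\<sigma> \<circ> \<pi>) + sensitivity n F (inv \<pi>)"
      using sensitivity_compose by metis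
  qed
  also have "\<dots> = (\<Sum>\<pi>\<in>?S. sensitivity n F \<pi>) + (\<Sum>\<pi>\<in>?S. sensitivity n F \<pi>)"
    using sum_permutations_inverse[of "sensitivity n F" J]
      setum_permutations_compose_left[OF assms(2), of "sensitivity n F"]
    by (simp add: sum.distrib)
  finally show ?thesis by (simp add: mult.commute)
qed

section \<open>Majority rounding\<close>

definition bits :: "nat \<Rightarrow> nat set \<Rightarrow> bool list" where
  "bits n X = map (\<lambda>i. i \<in> X) [0..<n]"

definition support :: "bool list \<Rightarrow> nat set" where
  "support x = {i. i < length x \<and> x ! i}"

lemma bits_in_cube [simp]: "bits n X \<in> cube n"
  by (simp add: bits_def cube_def)

lemma support_bits: "X \<subseteq> {..<n} \<Longrightarrow> support (bits n X) = X"
  by (auto simp: support_def bits_def)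

lemma bits_support: "x \<in> cube n \<Longrightarrow> bits n (support x) = x"
  by (auto simp: support_def bits_def cube_def intro!: nth_equalityI)

lemma support_subset: "x \<in> cube n \<Longrightarrow> support x \<subseteq> {..<n}"
  by (auto simp: support_def cube_def)

lemma bij_betw_bits: "bij_betw (bits n) (Pow {..<n}) (cube n)"
  by (rule bij_betw_byWitness[where f' = support])
    (auto simp: support_bits bits_support dest: support_subset)

lemma perm_act_bits:
  assumes "\<pi> permutes {..<n}"
  shows "perm_act n \<pi> (bits n X) = bits n (\<pi> ` X)"
proof -
  have "inv \<pi> j < n" if "j < n" for j
    using permutes_in_image[OF permutes_inv[OF assms], of j] that by simp
  moreover have "inv \<pi> j \<in> X \<longleftrightarrow> j \<in> \<pi> ` X" for j
    using permutes_inverses[OF assms] by (metis image_iff)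
  ultimately show ?thesis
    by (auto simp: perm_act_def bits_def)
qed

lemma J_symmetric_bits_iff:
  assumes "J \<subseteq> {..<n}"
  shows "J_symmetric n J f \<longleftrightarrow>
    (\<forall>X\<subseteq>{..<n}. \<forall>\<pi>. \<pi> permutes J \<longrightarrow> f (bits n (\<pi> ` X)) = f (bits n X))"
proof -
  have "cube n = bits n ` Pow {..<n}" using bij_betw_bits by (auto simp: bij_betw_def)
  then show ?thesis
    using perm_act_bits permutes_subset[OF _ assms] unfolding J_symmetric_def by auto
qed

text \<open>Replacing each value by the majority over the permutations of \<open>J\<close> yields a
  \<open>J\<close>-symmetric function, so it differs from \<open>f\<close> often. Wherever it does,
  at least half of the permutations change the value of \<open>f\<close>.\<close>

lemma far_imp_average_sensitivity:
  assumes far: "far_from_t_symmetric n t \<epsilon> f" and J: "J \<subseteq> {..<n}" "t \<le> card J"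
  shows "\<epsilon> / 2 * 2 ^ n * real (card {\<pi>. \<pi> permutes J})
    \<le> (\<Sum>\<pi> | \<pi> permutes J. real (sensitivity n (f \<circ> bits n) \<pi>))"
proof -
  let ?S = "{\<pi>. \<pi> permutes J}" and ?F = "f \<circ> bits n" and ?V = "Pow {..<n}"
  have fin: "finite ?S" using J(1) by (intro finite_permutations) (auto intro: finite_subset)
  \<comment> \<open>Ties go to \<open>True\<close>, which is why \<open>maj\<close> is a weak
    inequality.\<close>
  define G where "G X \<longleftrightarrow> card ?S \<le> 2 * card {\<pi>\<in>?S. ?F (\<pi> ` X)}" for X
  have G_inv: "G (\<rho> ` X) \<longleftrightarrow> G X" if \<rho>: "\<rho> permutes J" for \<rho> X
  proof -
    have "bij_betw (\<lambda>\<pi>. \<pi> \<circ> \<rho>) {\<pi>\<in>?S. ?F (\<pi> ` \<rho> ` X)} {\<pi>\<in>?S. ?F (\<pi> ` X)}"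
    proof (rule bij_betw_byWitness[where f' = "\<lambda>\<pi>. \<pi> \<circ> inv \<rho>"])
      show "(\<lambda>\<pi>. \<pi> \<circ> inv \<rho>) ` {\<pi>\<in>?S. ?F (\<pi> ` X)} \<subseteq> {\<pi>\<in>?S. ?F (\<pi> ` \<rho> ` X)}"
        using permutes_inv[OF \<rho>] by (auto simp: permutes_compose image_image permutes_inverses[OF \<rho>])
    qed (use \<rho> permutes_inv_o[OF \<rho>] in \<open>auto simp: permutes_compose image_comp o_assoc[symmetric]\<close>)
    then show ?thesis by (simp add: G_def bij_betw_same_card)
  qed
  have maj: "card ?S \<le> 2 * card {\<pi>\<in>?S. ?F (\<pi> ` X) \<noteq> ?F X}" if "?F X \<noteq> G X" for X
  proof (cases "?F X")
    case True
    have "card ?S = card {\<pi>\<in>?S. ?F (\<pi> ` X)} + card {\<pi>\<in>?S. \<not> ?F (\<pi> ` X)}"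
      using fin by (subst card_Un_disjoint[symmetric]) (auto intro!: arg_cong[of _ _ card])
    then show ?thesis using that True by (simp add: G_def)
  next
    case False
    then show ?thesis using that by (simp add: G_def)
  qed
  have "J_symmetric n J (G \<circ> support)"
    unfolding J_symmetric_bits_iff[OF J(1)]
  proof (intro allI impI)
    fix X \<pi> assume X: "X \<subseteq> {..<n}" and \<pi>: "\<pi> permutes J"
    have "\<pi> permutes {..<n}" using permutes_subset[OF \<pi> J(1)] .
    then have "\<pi> ` X \<subseteq> {..<n}" using X permutes_image by blast
    then show "(G \<circ> support) (bits n (\<pi> ` X)) = (G \<circ> support) (bits n X)"
      using X G_inv[OF \<pi>] by (simp add: support_bits)
  qed
  then have "t_symmetric n t (G \<circ> support)" using J unfolding t_symmetric_def by blast
  then have "\<epsilon> \<le> fdist n f (G \<circ> support)" using far unfolding far_from_t_symmetric_def by blast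
  also have "fdist n f (G \<circ> support) = real (card {X\<in>?V. ?F X \<noteq> G X}) / 2 ^ n"
  proof -
    have img: "bits n ` {X\<in>?V. ?F X \<noteq> G X} = {x\<in>cube n. f x \<noteq> (G \<circ> support) x}"
      by (auto simp: support_bits bits_support intro!: image_eqI[where x = "support _"]
          dest: subsetD[OF support_subset])
    have "inj_on (bits n) {X\<in>?V. ?F X \<noteq> G X}"
      using bij_betw_bits[of n] by (auto simp: bij_betw_def inj_on_def)
    from card_image[OF this] show ?thesis unfolding img fdist_def by simp
  qed
  finally have "\<epsilon> * 2 ^ n \<le> real (card {X\<in>?V. ?F X \<noteq> G X})" by (simp add: field_simps)
  then have "\<epsilon> * 2 ^ n * real (card ?S) \<le> real (card {X\<in>?V. ?F X \<noteq> G X} * card ?S)"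
    by (simp add: mult_right_mono)
  also have "card {X\<in>?V. ?F X \<noteq> G X} * card ?S
      = (\<Sum>X | X \<in> ?V \<and> ?F X \<noteq> G X. card ?S)" by simp
  also have "\<dots> \<le> (\<Sum>X | X \<in> ?V \<and> ?F X \<noteq> G X. 2 * card {\<pi>\<in>?S. ?F (\<pi> ` X) \<noteq> ?F X})"
    using maj by (intro sum_mono) auto
  also have "\<dots> \<le> (\<Sum>X\<in>?V. 2 * card {\<pi>\<in>?S. ?F (\<pi> ` X) \<noteq> ?F X})"
    by (intro sum_mono2) auto
  \<comment> \<open>The pairs of an input and a permutation changing its value are counted in two
    ways.\<close>
  also have "\<dots> = 2 * (\<Sum>X\<in>?V. \<Sum>\<pi>\<in>?S. of_bool (?F (\<pi> ` X) \<noteq> ?F X))"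
    using fin by (simp add: sum_distrib_left Int_def conj_commute)
  also have "\<dots> = 2 * (\<Sum>\<pi>\<in>?S. \<Sum>X\<in>?V. of_bool (?F (\<pi> ` X) \<noteq> ?F X))"
    by (subst sum.swap) simp
  also have "\<dots> = 2 * (\<Sum>\<pi>\<in>?S. sensitivity n ?F \<pi>)"
    by (simp add: sensitivity_def Int_def)
  finally show ?thesis by (simp add: field_simps)
qed

section \<open>Random colourings\<close>

text \<open>A worst-case bound over all permutations fixing \<open>D\<close> pointwise, since this
  form passes to intersections; its failure is turned into a bound on the average by
  \<open>sensitivity_le_average\<close>.\<close>

definition nearly_symmetric :: "nat \<Rightarrow> (nat set \<Rightarrow> bool) \<Rightarrow> real \<Rightarrow> nat set \<Rightarrow> bool" where
  "nearly_symmetric n F \<delta> D \<longleftrightarrow>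
     (\<forall>\<sigma>. \<sigma> permutes ({..<n} - D) \<longrightarrow> real (sensitivity n F \<sigma>) < \<delta>)"

lemma nearly_symmetric_mono:
  "nearly_symmetric n F \<delta> D \<Longrightarrow> \<delta> \<le> \<delta>' \<Longrightarrow> nearly_symmetric n F \<delta>' D"
  unfolding nearly_symmetric_def by force

lemma nearly_symmetric_nonneg: "nearly_symmetric n F \<delta> D \<Longrightarrow> 0 \<le> \<delta>"
  unfolding nearly_symmetric_def using permutes_id by (metis less_eq_real_def of_nat_0_le_iff order_le_less_trans)

text \<open>Sets of at most \<open>n / 10\<close> points leave enough room outside their union for
  the factorisation into three permutations, each costing \<open>\<delta>\<close>.\<close>

lemma nearly_symmetric_Int:
  assumes D: "D1 \<subseteq> {..<n}" "D2 \<subseteq> {..<n}" "10 * card D1 \<le> n" "10 * card D2 \<le> n"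
    and near: "nearly_symmetric n F \<delta> D1" "nearly_symmetric n F \<delta> D2"
  shows "nearly_symmetric n F (3 * \<delta>) (D1 \<inter> D2)"
proof -
  have fin: "finite D1" "finite D2" using D finite_subset by auto
  have "card (D2 - D1) \<le> card D2" using fin by (intro card_mono) auto
  moreover have "card ({..<n} - (D1 \<union> D2)) = n - card (D1 \<union> D2)"
    using D fin by (subst card_Diff_subset) auto
  moreover have "card (D1 \<union> D2) \<le> card D1 + card D2" by (rule card_Un_le)
  ultimately have "card (D2 - D1) \<le> card ({..<n} - (D1 \<union> D2))" using D by linarith
  then show ?thesis
    using sensitivity_intersection[OF _ D(1,2)] near unfolding nearly_symmetric_def by blast
qed

text \<open>With all other colours fixed, the colour of \<open>u\<close> is still uniform. The point
  \<open>v\<close> may lie outside \<open>V\<close>, where its colour is the default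
  \<open>d\<close>.\<close>

lemma prob_collision_le:
  assumes "finite V" "u \<in> V" "u \<noteq> v" "finite C" "C \<noteq> {}"
  shows "measure_pmf.prob (Pi_pmf V d (\<lambda>_. pmf_of_set C)) {h. h u = h v} \<le> 1 / card C"
proof -
  let ?P = "Pi_pmf (V - {u}) d (\<lambda>_. pmf_of_set C)"
  have "Pi_pmf V d (\<lambda>_. pmf_of_set C) = Pi_pmf (insert u (V - {u})) d (\<lambda>_. pmf_of_set C)"
    using assms by (simp add: insert_absorb)
  also have "\<dots> = bind_pmf ?P (\<lambda>f. map_pmf (\<lambda>y. f(u := y)) (pmf_of_set C))"
    using assms by (subst Pi_pmf_insert', simp, simp, subst bind_commute_pmf) (simp add: map_pmf_def)
  finally have "measure_pmf.prob (Pi_pmf V d (\<lambda>_. pmf_of_set C)) {h. h u = h v}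
      = (\<integral>f. measure_pmf.prob (pmf_of_set C) {f v} \<partial>measure_pmf ?P)"
    using assms by (simp add: prob_bind_pmf vimage_def Collect_conv_if)
  also have "\<dots> \<le> 1 / card C"
  proof (intro measure_pmf.integral_le_const measure_pmf.integrable_const_bound[where B=1])
    have "measure_pmf.prob (pmf_of_set C) {c} \<le> 1 / card C" for c
      using assms by (simp add: measure_pmf_single indicator_def)
    then show "AE f in measure_pmf ?P. measure_pmf.prob (pmf_of_set C) {f v} \<le> 1 / card C" by simp
  qed auto
  finally show ?thesis .
qed

lemma prob_not_inj_le:
  assumes "finite V" "S \<subseteq> V" "finite C" "C \<noteq> {}"
  shows "measure_pmf.prob (Pi_pmf V d (\<lambda>_. pmf_of_set C)) {h. \<not> inj_on h S} \<le> (card S)\<^sup>2 / card C"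
proof -
  let ?P = "Pi_pmf V d (\<lambda>_. pmf_of_set C)"
  let ?I = "S \<times> S - Id"
  have fin: "finite S" using assms finite_subset by auto
  have "measure_pmf.prob ?P {h. \<not> inj_on h S}
      \<le> measure_pmf.prob ?P (\<Union>(u, v)\<in>?I. {h. h u = h v})"
    by (intro measure_pmf.finite_measure_mono) (auto simp: inj_on_def)
  also have "\<dots> \<le> (\<Sum>(u, v)\<in>?I. measure_pmf.prob ?P {h. h u = h v})"
    using fin
    by (intro order_trans[OF measure_pmf.finite_measure_subadditive_finite])
      (auto simp: case_prod_unfold)
  also have "\<dots> \<le> (\<Sum>(u, v)\<in>?I. 1 / card C)"
    using assms by (intro sum_mono) (auto intro!: prob_collision_le)
  also have "\<dots> = card ?I / card C" by (simp add: case_prod_unfold)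
  also have "\<dots> \<le> (card S)\<^sup>2 / card C"
  proof -
    have "card ?I \<le> card (S \<times> S)" using fin by (intro card_mono) auto
    then show ?thesis
      by (intro divide_right_mono) (auto simp: card_cartesian_product power2_eq_square simp flip: of_nat_mult)
  qed
  finally show ?thesis .
qed

text \<open>If some set of at most \<open>8 * k\<close> coordinates carries almost all the asymmetry, a random colouring
  separates its elements.  Otherwise any two nearly symmetric sets meet in more than \<open>8 * k\<close> points,
  so a random colour class union lies above one of them with probability small enough for a union bound
  over all choices of \<open>k\<close> colours.\<close>
lemma random_colouring:
  fixes F :: "nat set \<Rightarrow> bool"
  assumes k: "1 \<le> k" "200 * k \<le> n" and r: "r = 640 * k\<^sup>2"
    and far: "\<And>D. D \<subseteq> {..<n} \<Longrightarrow> card D \<le> k \<Longrightarrow> \<not> nearly_symmetric n F (9 * \<delta>) D"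
  shows "measure_pmf.prob (Pi_pmf {..<n} r (\<lambda>_. pmf_of_set {..<r}))
    {h. \<exists>D K. D \<subseteq> {..<n} \<and> 10 * card D \<le> n \<and> K \<subseteq> {..<r} \<and> card K = k \<and> h ` D \<subseteq> K
        \<and> nearly_symmetric n F \<delta> D} \<le> 1 / 10"
    (is "measure_pmf.prob ?H ?bad \<le> _")
proof (cases "\<exists>S\<subseteq>{..<n}. card S \<le> 8 * k \<and> nearly_symmetric n F (3 * \<delta>) S")
  case True
  then obtain S where S: "S \<subseteq> {..<n}" "card S \<le> 8 * k" "nearly_symmetric n F (3 * \<delta>) S" by blast
  have rpos: "r > 0" using k r by simp
  \<comment> \<open>By \<open>far\<close>, a nearly symmetric \<open>D\<close> meets
    \<open>S\<close> in more than \<open>k\<close> points; an injective colouring of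
    \<open>S\<close> cannot fit these into \<open>k\<close> colours.\<close>
  have "?bad \<subseteq> {h. \<not> inj_on h S}"
  proof safe
    fix h D K
    assume D: "D \<subseteq> {..<n}" "10 * card D \<le> n" "K \<subseteq> {..<r}" "k = card K" "h ` D \<subseteq> K"
      "nearly_symmetric n F \<delta> D" and inj: "inj_on h S"
    have "nearly_symmetric n F (3 * \<delta>) D"
      using nearly_symmetric_mono[OF D(6)] nearly_symmetric_nonneg[OF D(6)] by simp
    then have "nearly_symmetric n F (3 * (3 * \<delta>)) (D \<inter> S)"
      using D S k by (intro nearly_symmetric_Int) auto
    then have "\<not> card (D \<inter> S) \<le> k" using far[of "D \<inter> S"] D(1) by auto
    moreover have "card (D \<inter> S) \<le> card K"
      using D(3,5) inj by (intro card_inj_on_le[of h]) (auto intro: inj_on_subset finite_subset)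
    ultimately show False using D(4) by simp
  qed
  then have "measure_pmf.prob ?H ?bad \<le> measure_pmf.prob ?H {h. \<not> inj_on h S}"
    by (intro measure_pmf.finite_measure_mono) auto
  also have "\<dots> \<le> (card S)\<^sup>2 / card {..<r}"
    using S rpos by (intro prob_not_inj_le) auto
  also have "\<dots> \<le> (8 * k)\<^sup>2 / card {..<r}"
    using S(2) by (intro divide_right_mono of_nat_mono power_mono) auto
  \<comment> \<open>The factor 640 in \<open>r\<close> is chosen for this.\<close>
  also have "\<dots> = 1 / 10" using k by (simp add: r power2_eq_square field_simps)
  finally show ?thesis .
next
  case False
  define A where "A = {b. \<exists>D\<subseteq>{..<n}. 10 * card D \<le> n \<and> nearly_symmetric n F \<delta> D \<and> (\<forall>v\<in>D. b v)}"
  have rpos: "r > 0" using k r by simp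
  have inter: "8 * k \<le> card {v\<in>{..<n}. f v \<and> g v}" if "f \<in> A" "g \<in> A" for f g
  proof -
    from that(1) obtain D1 where D1: "D1 \<subseteq> {..<n}" "10 * card D1 \<le> n" "nearly_symmetric n F \<delta> D1"
      "\<forall>v\<in>D1. f v" by (auto simp: A_def)
    from that(2) obtain D2 where D2: "D2 \<subseteq> {..<n}" "10 * card D2 \<le> n" "nearly_symmetric n F \<delta> D2"
      "\<forall>v\<in>D2. g v" by (auto simp: A_def)
    have "nearly_symmetric n F (3 * \<delta>) (D1 \<inter> D2)"
      by (rule nearly_symmetric_Int[OF D1(1) D2(1) D1(2) D2(2) D1(3) D2(3)])
    moreover have "D1 \<inter> D2 \<subseteq> {..<n}" using D1(1) by blast
    ultimately have "\<not> card (D1 \<inter> D2) \<le> 8 * k" using False by blast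
    then have "8 * k \<le> card (D1 \<inter> D2)" by simp
    also have "\<dots> \<le> card {v\<in>{..<n}. f v \<and> g v}" using D1 D2 by (intro card_mono) auto
    finally show ?thesis .
  qed
  let ?\<K> = "{K. K \<subseteq> {..<r} \<and> card K = k}"
  have single: "measure_pmf.prob ?H {h. (\<lambda>v. h v \<in> K) \<in> A} \<le> (k / r) ^ (4 * k)" if "K \<in> ?\<K>" for K
  proof -
    define q where "q = map_pmf (\<lambda>c. c \<in> K) (pmf_of_set {..<r})"
    have "pmf q True = measure_pmf.prob (pmf_of_set {..<r}) K"
      by (simp add: q_def pmf_map vimage_def)
    also have "\<dots> = k / r" using that rpos
      by (subst measure_pmf_of_set) (auto simp: Int_absorb1)
    finally have q: "pmf q True = k / r" .
    \<comment> \<open>Membership of the colours in a fixed \<open>K\<close> gives independent bits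
      of bias \<open>k / r\<close>.\<close>
    have "Pi_pmf {..<n} False (\<lambda>_. q) = map_pmf (\<lambda>h. (\<lambda>c. c \<in> K) \<circ> h) ?H"
      unfolding q_def using that by (subst Pi_pmf_map[where dflt = r]) auto
    then have "measure_pmf.prob ?H {h. (\<lambda>v. h v \<in> K) \<in> A} = measure_pmf.prob (Pi_pmf {..<n} False (\<lambda>_. q)) A"
      by (simp add: vimage_def o_def)
    \<comment> \<open>The family \<open>A\<close> is crossed with itself; taking the square root
      halves the exponent to \<open>4 * k\<close>.\<close>
    moreover have "measure_pmf.prob (Pi_pmf {..<n} False (\<lambda>_. q)) A
        * measure_pmf.prob (Pi_pmf {..<n} False (\<lambda>_. q)) A \<le> pmf q True ^ (8 * k)"
      using inter k
      by (intro cross_intersecting_measure) (auto simp: q r power2_eq_square field_simps)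
    ultimately have "(measure_pmf.prob ?H {h. (\<lambda>v. h v \<in> K) \<in> A})\<^sup>2 \<le> ((k / r) ^ (4 * k))\<^sup>2"
      by (simp add: q power2_eq_square flip: power_add)
    then show ?thesis by (rule power2_le_imp_le) simp
  qed
  have "?bad \<subseteq> (\<Union>K\<in>?\<K>. {h. (\<lambda>v. h v \<in> K) \<in> A})" unfolding A_def by blast
  then have "measure_pmf.prob ?H ?bad \<le> measure_pmf.prob ?H (\<Union>K\<in>?\<K>. {h. (\<lambda>v. h v \<in> K) \<in> A})"
    by (intro measure_pmf.finite_measure_mono) auto
  also have "\<dots> \<le> (\<Sum>K\<in>?\<K>. measure_pmf.prob ?H {h. (\<lambda>v. h v \<in> K) \<in> A})"
    by (intro measure_pmf.finite_measure_subadditive_finite) auto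
  also have "\<dots> \<le> (\<Sum>K\<in>?\<K>. (k / r) ^ (4 * k))" by (intro sum_mono single)
  also have "\<dots> = (r choose k) * (k / r) ^ (4 * k)" by (simp add: n_subsets)
  also have "\<dots> \<le> r ^ k * (k / r) ^ (4 * k)"
  proof -
    have "k \<le> r" using r k by (simp add: power2_eq_square)
    then have "r choose k \<le> r ^ k" by (rule binomial_le_pow)
    then show ?thesis by (intro mult_right_mono) (auto simp flip: of_nat_power)
  qed
  also have "\<dots> = (r * (k / r) ^ 4) ^ k" by (simp add: power_mult power_mult_distrib)
  \<comment> \<open>Each of the \<open>k\<close> colours costs a factor \<open>r\<close> in the
    union bound and gains \<open>(k / r) ^ 4\<close>.\<close>
  also have "r * (k / r) ^ 4 = 1 / (640 ^ 3 * (real k)\<^sup>2)"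
    using k by (simp add: r field_simps eval_nat_numeral)
  also have "\<dots> ^ k \<le> (1 / 10) ^ k"
  proof (intro power_mono)
    have "1 \<le> (real k)\<^sup>2" using k by simp
    then have "10 * 1 \<le> 640 ^ 3 * (real k)\<^sup>2" by (intro mult_mono) auto
    then show "1 / (640 ^ 3 * (real k)\<^sup>2) \<le> 1 / 10" by (intro frac_le) linarith+
  qed auto
  also have "\<dots> \<le> (1 / 10) ^ 1" using k by (intro power_decreasing) auto
  finally show ?thesis by simp
qed

section \<open>Rewriting block by block\<close>

text \<open>A block can be rewritten as soon as the workspace \<open>W\<close> can absorb the change of weight; when no
  block qualifies, all the changes of weight have the same sign and are too large to cancel.\<close>
lemma rewritable_block:
  fixes B :: "'i \<Rightarrow> 'a set"
  assumes fin: "finite S" "finite X" "finite Y" "finite W" and ne: "S \<noteq> {}"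
    and XY: "card X = card Y" "X - (W \<union> \<Union>(B ` S)) = Y - (W \<union> \<Union>(B ` S))"
    and B: "\<And>j. j \<in> S \<Longrightarrow> finite (B j) \<and> card (B j) \<le> L \<and> B j \<inter> W = {}"
    and disj: "disjoint_family_on B S" and L: "2 * L \<le> card W + 1"
  obtains j where "j \<in> S" "card (Y \<inter> B j) \<le> card (X \<inter> W) + card (X \<inter> B j)"
    "card (X \<inter> W) + card (X \<inter> B j) \<le> card W + card (Y \<inter> B j)"
proof -
  have split: "card A = card (A \<inter> W) + (\<Sum>j\<in>S. card (A \<inter> B j)) + card (A - (W \<union> \<Union>(B ` S)))"
    if "finite A" for A
  proof -
    have "A = (A \<inter> W) \<union> (\<Union>j\<in>S. A \<inter> B j) \<union> (A - (W \<union> \<Union>(B ` S)))" by auto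
    also have "card \<dots> = card ((A \<inter> W) \<union> (\<Union>j\<in>S. A \<inter> B j)) + card (A - (W \<union> \<Union>(B ` S)))"
      using that fin by (intro card_Un_disjoint) auto
    also have "card ((A \<inter> W) \<union> (\<Union>j\<in>S. A \<inter> B j)) = card (A \<inter> W) + card (\<Union>j\<in>S. A \<inter> B j)"
      using that fin B by (intro card_Un_disjoint) auto
    also have "card (\<Union>j\<in>S. A \<inter> B j) = (\<Sum>j\<in>S. card (A \<inter> B j))"
      using that fin disj by (intro card_UN_disjoint) (auto simp: disjoint_family_on_def)
    finally show ?thesis .
  qed
  define w x y where "w = card (X \<inter> W)" and "x j = card (X \<inter> B j)" and "y j = card (Y \<inter> B j)" for j
  have eq: "w + sum x S = card (Y \<inter> W) + sum y S"
    using split[OF fin(2)] split[OF fin(3)] XY by (simp add: w_def x_def y_def)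
  have YW: "card (Y \<inter> W) \<le> card W" and w: "w \<le> card W"
    using fin by (auto simp: w_def intro: card_mono)
  have le: "x j \<le> L \<and> y j \<le> L" if "j \<in> S" for j
    using B[OF that] unfolding x_def y_def
    by (meson card_mono inf_le2 order_trans)
  have strict: "m + sum u S < sum v S" if "\<And>j. j \<in> S \<Longrightarrow> m + u j < v j" for m and u v :: "'i \<Rightarrow> nat"
  proof -
    obtain j where j: "j \<in> S" using ne by blast
    have "sum u (S - {j}) \<le> sum v (S - {j})" using that by (intro sum_mono) (meson DiffD1 add_leE less_imp_le)
    then show ?thesis using that[OF j] fin(1) j by (simp add: sum.remove[of S j])
  qed
  have "\<exists>j\<in>S. y j \<le> w + x j \<and> w + x j \<le> card W + y j"
  proof (rule ccontr)
    assume no: "\<not> ?thesis"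
    show False
    proof (cases "L \<le> w")
      case True
      have "(card W - w) + y j < x j" if "j \<in> S" for j using no that le[OF that] True w by force
      then have "(card W - w) + sum y S < sum x S" by (rule strict)
      then show False using eq YW w by linarith
    next
      case False
      have "w + x j < y j" if "j \<in> S" for j using no that le[OF that] False L w by force
      then have "w + sum x S < sum y S" by (rule strict)
      then show False using eq by linarith
    qed
  qed
  then show thesis using that by (auto simp: w_def x_def y_def)
qed

text \<open>Induction on the number of blocks: some block can take its final content while
  \<open>W\<close> absorbs the change of weight, and the last block is finished together with
  \<open>W\<close>. The path rests at \<open>Y\<close> from index \<open>card S\<close> on, so it
  may be read as a longer one.\<close>

lemma block_path:
  fixes B :: "'i \<Rightarrow> 'a set"
  assumes V: "finite V" "W \<subseteq> V" "X \<subseteq> V" "Y \<subseteq> V"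
    and S: "finite S" "S \<noteq> {}"
    and XY: "card X = card Y" "X - (W \<union> \<Union>(B ` S)) = Y - (W \<union> \<Union>(B ` S))"
    and B: "\<And>j. j \<in> S \<Longrightarrow> B j \<subseteq> V \<and> card (B j) \<le> L \<and> B j \<inter> W = {}"
    and disj: "disjoint_family_on B S" and L: "2 * L \<le> card W + 1"
  shows "\<exists>Z l. Z 0 = X \<and> (\<forall>i\<ge>card S. Z i = Y) \<and>
    (\<forall>i. Z i \<subseteq> V \<and> l i \<in> S \<and> (\<exists>\<rho>. \<rho> permutes (W \<union> B (l i)) \<and> Z (Suc i) = \<rho> ` Z i))"
  using S XY B disj V(3)
proof (induction "card S" arbitrary: S X rule: less_induct)
  case less
  note fin = finite_subset[OF _ V(1)]
  have finB: "finite (B j)" if "j \<in> S" for j using less.prems(5)[OF that] fin by blast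
  obtain j where j: "j \<in> S" "card (Y \<inter> B j) \<le> card (X \<inter> W) + card (X \<inter> B j)"
    "card (X \<inter> W) + card (X \<inter> B j) \<le> card W + card (Y \<inter> B j)"
    using rewritable_block[of S X Y W B L] less.prems V fin L by metis
  show ?case
  proof (cases "S = {j}")
    case True
    have "finite (W \<union> B j)" using finB j(1) fin V(2) by blast
    then obtain \<rho> where \<rho>: "\<rho> permutes (W \<union> B j)" "\<rho> ` X = Y"
      using permutation_mapping_set[of "W \<union> B j" X Y] less.prems V fin True by auto
    \<comment> \<open>Past the end the step permutation is the identity and the label stays a valid
      block.\<close>
    let ?Z = "\<lambda>i::nat. if i = 0 then X else Y"
    have "\<exists>\<rho>. \<rho> permutes (W \<union> B j) \<and> ?Z (Suc i) = \<rho> ` ?Z i" for i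
    proof (cases i)
      case 0
      then show ?thesis using \<rho> by auto
    next
      case (Suc _)
      then show ?thesis using permutes_id by (intro exI[of _ id]) auto
    qed
    then show ?thesis
      using True less.prems V by (intro exI[of _ ?Z] exI[of _ "\<lambda>_. j"]) auto
  next
    case False
    have "card (X \<inter> W) + card (X \<inter> B j) - card (Y \<inter> B j) \<le> card W" using j(3) by linarith
    then obtain W' where W': "W' \<subseteq> W" "card W' = card (X \<inter> W) + card (X \<inter> B j) - card (Y \<inter> B j)"
      by (rule obtain_subset_with_card_n)
    let ?S' = "S - {j}"
    define X' where "X' = (X - (W \<union> B j)) \<union> (Y \<inter> B j) \<union> W'"
    have jW: "B j \<inter> W = {}" using less.prems(5) j by blast
    have finX: "finite X" "finite Y" "finite W" using fin V less.prems by auto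
    have "card X' = card (X - (W \<union> B j)) + card (Y \<inter> B j) + card W'"
      unfolding X'_def using finX W' jW finB[OF j(1)]
      by (subst card_Un_disjoint; (subst card_Un_disjoint)?) (auto intro: finite_subset)
    also have "\<dots> = card (X - (W \<union> B j)) + (card (X \<inter> W) + card (X \<inter> B j))"
      using W'(2) j by simp
    also have "card (X \<inter> W) + card (X \<inter> B j) = card (X \<inter> (W \<union> B j))"
      using finX jW by (subst card_Un_disjoint[symmetric]) (auto simp: Int_Un_distrib)
    also have "card (X - (W \<union> B j)) + card (X \<inter> (W \<union> B j)) = card X"
      using card_Int_Diff[OF finX(1), of "W \<union> B j"] by simp
    finally have cX': "card X' = card X" .
    have X'V: "X' \<subseteq> V" using W' V less.prems by (auto simp: X'_def)
    have out: "X' - (W \<union> B j) = X - (W \<union> B j)" using W' by (auto simp: X'_def)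
    have disj': "B i \<inter> B j = {}" if "i \<in> ?S'" for i
      using less.prems(6) j that by (auto simp: disjoint_family_on_def)
    have "X' - (W \<union> \<Union>(B ` ?S')) = Y - (W \<union> \<Union>(B ` ?S'))" (is "?l = ?r")
    proof (rule set_eqI)
      fix a
      have "a \<in> X \<longleftrightarrow> a \<in> Y" if "a \<notin> W" "a \<notin> B j" "\<forall>i\<in>?S'. a \<notin> B i"
        using less.prems(4) that by blast
      then show "a \<in> ?l \<longleftrightarrow> a \<in> ?r" using W' jW by (auto simp: X'_def)
    qed
    moreover have "card ?S' < card S" using j(1) less.prems(1) by (meson card_Diff1_less)
    moreover have "?S' \<noteq> {}" using False j(1) by blast
    moreover have "disjoint_family_on B ?S'" using less.prems(6) by (auto simp: disjoint_family_on_def)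
    ultimately have "\<exists>Z l. Z 0 = X' \<and> (\<forall>i\<ge>card ?S'. Z i = Y) \<and>
        (\<forall>i. Z i \<subseteq> V \<and> l i \<in> ?S' \<and> (\<exists>\<rho>. \<rho> permutes (W \<union> B (l i)) \<and> Z (Suc i) = \<rho> ` Z i))"
      using less.prems(1,3,5) cX' X'V by (intro less.hyps) auto
    then obtain Z l where Z: "Z 0 = X'" "\<forall>i\<ge>card ?S'. Z i = Y"
      "\<And>i. Z i \<subseteq> V \<and> l i \<in> ?S' \<and> (\<exists>\<rho>. \<rho> permutes (W \<union> B (l i)) \<and> Z (Suc i) = \<rho> ` Z i)"
      by blast
    obtain \<rho> where \<rho>: "\<rho> permutes (W \<union> B j)" "\<rho> ` X = X'"
      using permutation_mapping_set[of "W \<union> B j" X X'] finX finB[OF j(1)] fin[OF X'V] cX' out by auto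
    have "case_nat X Z i \<subseteq> V \<and> case_nat j l i \<in> S \<and>
        (\<exists>\<rho>. \<rho> permutes (W \<union> B (case_nat j l i)) \<and> case_nat X Z (Suc i) = \<rho> ` case_nat X Z i)" for i
      using Z(1,3) \<rho>(1) \<rho>(2)[symmetric] less.prems(7) j(1) by (cases i) auto
    moreover have "\<forall>i\<ge>card S. case_nat X Z i = Y"
    proof (intro allI impI)
      fix i assume "card S \<le> i"
      moreover have "card S = Suc (card ?S')" using card.remove[OF less.prems(1) j(1)] .
      ultimately show "case_nat X Z i = Y" using Z(2) by (cases i) auto
    qed
    ultimately show ?thesis by (intro exI[of _ "case_nat X Z"] exI[of _ "case_nat j l"]) simp
  qed
qed

section \<open>The tester\<close>

text \<open>Here \<open>b\<close> is the value at \<open>lo\<close>, the value at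
  \<open>lo + 2 ^ d\<close> is known to differ, and the continuation \<open>c\<close> receives the
  index of a step that changes the value.\<close>

primrec bsearch :: "(nat \<Rightarrow> bool list) \<Rightarrow> nat \<Rightarrow> nat \<Rightarrow> bool \<Rightarrow> (nat \<Rightarrow> qtree) \<Rightarrow> qtree" where
  "bsearch z 0 lo b c = c lo"
| "bsearch z (Suc d) lo b c =
     Query (z (lo + 2 ^ d)) (\<lambda>b'. if b' = b then bsearch z d (lo + 2 ^ d) b c else bsearch z d lo b c)"

lemma run_bsearch:
  assumes "f (z lo) = b" "f (z (lo + 2 ^ d)) \<noteq> b"
  obtains i where "f (z i) \<noteq> f (z (Suc i))" "\<And>c. run f (bsearch z d lo b c) = run f (c i)"
proof -
  have "\<exists>i. f (z i) \<noteq> f (z (Suc i)) \<and> (\<forall>c. run f (bsearch z d lo b c) = run f (c i))"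
    using assms
  proof (induction d arbitrary: lo)
    case 0
    then show ?case by (intro exI[of _ lo]) auto
  next
    case (Suc d)
    then show ?case using Suc.IH[of lo] Suc.IH[of "lo + 2 ^ d"]
      by (cases "f (z (lo + 2 ^ d)) = b") (auto simp: mult_2 add.assoc)
  qed
  then show thesis using that by blast
qed

lemma depth_bsearch: "(\<And>i. depth (c i) \<le> m) \<Longrightarrow> depth (bsearch z d lo b c) \<le> d + m"
  by (induction d arbitrary: lo) auto

lemma queries_in_bsearch:
  "(\<And>i. z i \<in> cube n) \<Longrightarrow> (\<And>i. queries_in n (c i)) \<Longrightarrow> queries_in n (bsearch z d lo b c)"
  by (induction d arbitrary: lo) auto

text \<open>\<open>D\<close> is the set of blocks found so far; a round's random choice \<open>s\<close> offers a pair \<open>(X, \<pi>)\<close> for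
  each possible union of found blocks; \<open>P D X Y\<close> is a path from \<open>X\<close> to \<open>Y\<close> with the block changed
  at each step.\<close>
primrec tester :: "nat \<Rightarrow> nat \<Rightarrow> nat \<Rightarrow> ('i \<Rightarrow> nat set)
    \<Rightarrow> ('i set \<Rightarrow> nat set \<Rightarrow> nat set \<Rightarrow> (nat \<Rightarrow> nat set) \<times> (nat \<Rightarrow> 'i))
    \<Rightarrow> (nat set \<Rightarrow> nat set \<times> (nat \<Rightarrow> nat)) list \<Rightarrow> 'i set \<Rightarrow> qtree" where
  "tester n k d B P [] D = Leaf (card D \<le> k)"
| "tester n k d B P (s # ss) D =
    (if k < card D then Leaf False
     else let X = fst (s (\<Union>(B ` D))); Y = snd (s (\<Union>(B ` D))) ` X in
       Query (bits n X) (\<lambda>b. Query (bits n Y) (\<lambda>b'.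
         if b' = b then tester n k d B P ss D
         else bsearch (\<lambda>i. bits n (fst (P D X Y) i)) d 0 b
                (\<lambda>i. tester n k d B P ss (insert (snd (P D X Y) i) D)))))"

lemma depth_tester: "depth (tester n k d B P ss D) \<le> length ss * (d + 2)"
proof (induction ss arbitrary: D)
  case (Cons s ss)
  show ?case
    by (auto simp: Let_def intro!: order_trans[OF depth_bsearch[OF Cons.IH]] order_trans[OF Cons.IH])
qed simp

lemma queries_in_tester: "queries_in n (tester n k d B P ss D)"
  by (induction ss arbitrary: D) (auto simp: Let_def queries_in_bsearch)

lemma not_run_tester:
  assumes "k < card D"
  shows "\<not> run f (tester n k d B P ss D)"
  using assms by (cases ss) auto

section \<open>Admissible coins and paths\<close>

definition valid_choice :: "nat \<Rightarrow> (nat set \<Rightarrow> nat set \<times> (nat \<Rightarrow> nat)) \<Rightarrow> bool" where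
  "valid_choice n s \<longleftrightarrow> (\<forall>U\<subseteq>{..<n}. fst (s U) \<subseteq> {..<n} \<and> snd (s U) permutes ({..<n} - U))"

text \<open>The length \<open>2 ^ d\<close> suits the binary search, and labels in
  \<open>I - D\<close> ensure that every search yields a new block.\<close>

definition valid_paths :: "nat \<Rightarrow> nat \<Rightarrow> nat \<Rightarrow> nat set \<Rightarrow> 'i set \<Rightarrow> ('i \<Rightarrow> nat set)
    \<Rightarrow> ('i set \<Rightarrow> nat set \<Rightarrow> nat set \<Rightarrow> (nat \<Rightarrow> nat set) \<times> (nat \<Rightarrow> 'i)) \<Rightarrow> bool" where
  "valid_paths n k d W I B P \<longleftrightarrow> (\<forall>D X \<pi>. D \<subseteq> I \<longrightarrow> card D \<le> k \<longrightarrow> X \<subseteq> {..<n} \<longrightarrow>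
     \<pi> permutes ({..<n} - \<Union>(B ` D)) \<longrightarrow>
     fst (P D X (\<pi> ` X)) 0 = X \<and> fst (P D X (\<pi> ` X)) (2 ^ d) = \<pi> ` X \<and>
     (\<forall>i. fst (P D X (\<pi> ` X)) i \<subseteq> {..<n} \<and> snd (P D X (\<pi> ` X)) i \<in> I - D \<and>
        (\<exists>\<rho>. \<rho> permutes (W \<union> B (snd (P D X (\<pi> ` X)) i)) \<and>
             fst (P D X (\<pi> ` X)) (Suc i) = \<rho> ` fst (P D X (\<pi> ` X)) i)))"

text \<open>Apply \<open>block_path\<close> to the blocks not yet found: \<open>\<pi>\<close> fixes
  the found ones, so \<open>X\<close> and its image agree outside \<open>W\<close> and the remaining
  blocks.\<close>

lemma ex_valid_paths:
  assumes "W \<subseteq> {..<n}" "finite I" "k < card I" "card I \<le> 2 ^ d"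
    and B: "\<And>j. j \<in> I \<Longrightarrow> B j \<subseteq> {..<n} \<and> card (B j) \<le> L \<and> B j \<inter> W = {}"
    and cover: "{..<n} \<subseteq> W \<union> \<Union>(B ` I)" and disj: "disjoint_family_on B I" and L: "2 * L \<le> card W + 1"
  obtains P where "valid_paths n k d W I B P"
proof -
  let ?Q = "\<lambda>D X Y (p :: (nat \<Rightarrow> nat set) \<times> (nat \<Rightarrow> 'a)). fst p 0 = X \<and> fst p (2 ^ d) = Y \<and>
     (\<forall>i. fst p i \<subseteq> {..<n} \<and> snd p i \<in> I - D \<and>
        (\<exists>\<rho>. \<rho> permutes (W \<union> B (snd p i)) \<and> fst p (Suc i) = \<rho> ` fst p i))"
  define P where "P D X Y = (SOME p. ?Q D X Y p)" for D X Y
  have "?Q D X (\<pi> ` X) (P D X (\<pi> ` X))"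
    if D: "D \<subseteq> I" "card D \<le> k" "X \<subseteq> {..<n}" and \<pi>: "\<pi> permutes ({..<n} - \<Union>(B ` D))" for D X \<pi>
  proof -
    have \<pi>n: "\<pi> permutes {..<n}" using permutes_subset[OF \<pi>] by blast
    have fin: "finite (I - D)" using assms(2) by simp
    \<comment> \<open>Even the resting part of a path needs a label.\<close>
    have ne: "I - D \<noteq> {}" using D(1,2) assms(2,3) card_mono[of D I] finite_subset[OF D(1)] by auto
    have weight: "card X = card (\<pi> ` X)" using permutes_inj[OF \<pi>]
      by (metis card_image inj_on_subset subset_UNIV)
    have agree: "X - (W \<union> \<Union>(B ` (I - D))) = \<pi> ` X - (W \<union> \<Union>(B ` (I - D)))" (is "X - ?R = _")
    proof -
      have fix1: "\<pi> a = a" if "a \<in> \<Union>(B ` D)" for a using permutes_not_in[OF \<pi>] that by blast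
      have "a \<in> X \<longleftrightarrow> a \<in> \<pi> ` X" if "a \<notin> ?R" for a
      proof (cases "a \<in> {..<n}")
        case True
        then have "a \<in> \<Union>(B ` D)" using that cover by blast
        then show ?thesis using fix1 permutes_inj[OF \<pi>] by (metis image_iff injD)
      next
        case False
        then show ?thesis using D(3) permutes_in_image[OF \<pi>n] by auto
      qed
      then show ?thesis by blast
    qed
    have im: "\<pi> ` X \<subseteq> {..<n}" using D(3) permutes_image[OF \<pi>n] by blast
    have disj': "disjoint_family_on B (I - D)" using disj by (auto simp: disjoint_family_on_def)
    obtain Z l where Z: "Z 0 = X" "\<forall>i\<ge>card (I - D). Z i = \<pi> ` X"
      "\<forall>i. Z i \<subseteq> {..<n} \<and> l i \<in> I - D \<and> (\<exists>\<rho>. \<rho> permutes (W \<union> B (l i)) \<and> Z (Suc i) = \<rho> ` Z i)"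
      using block_path[OF finite_lessThan assms(1) D(3) im fin ne weight agree B disj' L] by blast
    moreover have "card (I - D) \<le> 2 ^ d" using assms(2,4) card_mono[of I "I - D"] by auto
    ultimately have "?Q D X (\<pi> ` X) (Z, l)" by simp
    then show ?thesis unfolding P_def by (rule someI)
  qed
  then have "valid_paths n k d W I B P" unfolding valid_paths_def by blast
  then show thesis by (rule that)
qed

text \<open>Once the two comparison queries differ, the binary search ends at a step of the path
  that changes \<open>f\<close>. Both completeness and soundness start from this.\<close>

lemma run_tester_step:
  assumes "valid_paths n k d W I B P" "valid_choice n s" "D \<subseteq> I" "card D \<le> k"
    and B: "\<And>j. j \<in> I \<Longrightarrow> B j \<subseteq> {..<n}"
    and ne: "f (bits n (snd (s (\<Union>(B ` D))) ` fst (s (\<Union>(B ` D))))) \<noteq> f (bits n (fst (s (\<Union>(B ` D)))))"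
  obtains j Z \<rho> where "j \<in> I - D" "Z \<subseteq> {..<n}" "\<rho> permutes (W \<union> B j)"
    "f (bits n (\<rho> ` Z)) \<noteq> f (bits n Z)"
    "\<And>ss. run f (tester n k d B P (s # ss) D) = run f (tester n k d B P ss (insert j D))"
proof -
  define X \<pi> where "X = fst (s (\<Union>(B ` D)))" and "\<pi> = snd (s (\<Union>(B ` D)))"
  have "\<Union>(B ` D) \<subseteq> {..<n}" using B assms(3) by blast
  then have X: "X \<subseteq> {..<n}" "\<pi> permutes ({..<n} - \<Union>(B ` D))"
    using assms(2) unfolding valid_choice_def X_def \<pi>_def by blast+
  define Z l where "Z = fst (P D X (\<pi> ` X))" and "l = snd (P D X (\<pi> ` X))"
  have p: "Z 0 = X" "Z (2 ^ d) = \<pi> ` X"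
    "\<And>i. Z i \<subseteq> {..<n} \<and> l i \<in> I - D \<and> (\<exists>\<rho>. \<rho> permutes (W \<union> B (l i)) \<and> Z (Suc i) = \<rho> ` Z i)"
    using assms(1)[unfolded valid_paths_def, rule_format, OF assms(3,4) X] unfolding Z_def l_def by auto
  have ends: "f (bits n (Z 0)) = f (bits n X)" "f (bits n (Z (0 + 2 ^ d))) \<noteq> f (bits n X)"
    using p ne by (auto simp: X_def \<pi>_def)
  obtain i where i: "f (bits n (Z i)) \<noteq> f (bits n (Z (Suc i)))"
    "\<And>c. run f (bsearch (\<lambda>i. bits n (Z i)) d 0 (f (bits n X)) c) = run f (c i)"
    using run_bsearch[where z = "\<lambda>i. bits n (Z i)", OF ends] by blast
  have "run f (tester n k d B P (s # ss) D) = run f (tester n k d B P ss (insert (l i) D))" for ss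
    using ne assms(4) i(2)[of "\<lambda>i. tester n k d B P ss (insert (l i) D)"]
    by (simp add: Let_def X_def \<pi>_def Z_def l_def)
  moreover obtain \<rho> where "\<rho> permutes (W \<union> B (l i))" "Z (Suc i) = \<rho> ` Z i" using p(3) by blast
  ultimately show thesis using that[of "l i" "Z i" \<rho>] p(3)[of i] i(1) by simp
qed

section \<open>Completeness\<close>

text \<open>Choose a point outside \<open>J\<close> in each set; disjointness makes the choice
  injective. This serves for blocks and for workspaces.\<close>

lemma card_blocks_meeting:
  assumes "disjoint_family_on B I" "finite V" "D \<subseteq> I"
    and D: "\<And>j. j \<in> D \<Longrightarrow> B j \<subseteq> V \<and> \<not> B j \<subseteq> J"
  shows "card D \<le> card (V - J)"
proof -
  define e where "e j = (SOME a. a \<in> B j - J)" for j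
  have e: "e j \<in> B j - J" if "j \<in> D" for j
    unfolding e_def by (rule someI_ex) (use D[OF that] in blast)
  have "inj_on e D"
  proof (rule inj_onI)
    fix i j assume "i \<in> D" "j \<in> D" "e i = e j"
    then show "i = j" using e[of i] e[of j] assms(1,3) by (force simp: disjoint_family_on_def)
  qed
  moreover have "e ` D \<subseteq> V - J" using e D by blast
  ultimately show ?thesis using assms(2) by (intro card_inj_on_le) auto
qed

text \<open>A step of a path that changes \<open>f\<close> exhibits a block meeting the complement of \<open>J\<close>, since \<open>W\<close>
  does not; the blocks being disjoint, there are at most \<open>k\<close> of them.\<close>
lemma tester_complete:
  assumes f: "J_symmetric n J f" "J \<subseteq> {..<n}" "card ({..<n} - J) \<le> k" "W \<subseteq> J"
    and P: "valid_paths n k d W I B P"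
    and B: "\<And>j. j \<in> I \<Longrightarrow> B j \<subseteq> {..<n}" and disj: "disjoint_family_on B I"
    and ss: "\<And>s. s \<in> set ss \<Longrightarrow> valid_choice n s"
    and D: "D \<subseteq> {j\<in>I. \<not> B j \<subseteq> J}"
  shows "run f (tester n k d B P ss D)"
  using ss D
proof (induction ss arbitrary: D)
  have small: "card D \<le> k" if "D \<subseteq> {j\<in>I. \<not> B j \<subseteq> J}" for D
  proof -
    have "card D \<le> card ({..<n} - J)"
      using B that by (intro card_blocks_meeting[OF disj]) auto
    then show ?thesis using f(3) by simp
  qed
  {
    case Nil
    then show ?case using small by simp
  next
    case (Cons s ss)
    let ?s = "s (\<Union>(B ` D))"
    have DI: "D \<subseteq> I" using Cons.prems(2) by blast
    have IH: "run f (tester n k d B P ss D')" if "D' \<subseteq> {j\<in>I. \<not> B j \<subseteq> J}" for D'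
      using Cons.IH[OF _ that] Cons.prems(1) by simp
    show ?case
    proof (cases "f (bits n (snd ?s ` fst ?s)) = f (bits n (fst ?s))")
      case True
      then show ?thesis using small[OF Cons.prems(2)] IH[OF Cons.prems(2)] by (simp add: Let_def)
    next
      case False
      obtain j Z \<rho> where j: "j \<in> I - D" "Z \<subseteq> {..<n}" "\<rho> permutes (W \<union> B j)"
        "f (bits n (\<rho> ` Z)) \<noteq> f (bits n Z)"
        "\<And>ss. run f (tester n k d B P (s # ss) D) = run f (tester n k d B P ss (insert j D))"
        using run_tester_step[of n k d W I B P s D f] P Cons.prems(1) DI small[OF Cons.prems(2)] B False
        by (metis list.set_intros(1))
      have "\<not> B j \<subseteq> J"
      proof
        assume "B j \<subseteq> J"
        then have "\<rho> permutes J" using permutes_subset[OF j(3)] f(4) by blast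
        then show False using f(1) j(2,4) unfolding J_symmetric_bits_iff[OF f(2)] by blast
      qed
      then show ?thesis using j(1,5) IH[of "insert j D"] Cons.prems(2) by simp
    qed
  }
qed

section \<open>Random rounds and soundness\<close>

text \<open>The coins are drawn in advance for every \<open>U\<close> that an adaptive run might
  reach, so that fixing them leaves a deterministic decision tree.\<close>

definition round_pmf :: "nat \<Rightarrow> (nat set \<Rightarrow> nat set \<times> (nat \<Rightarrow> nat)) pmf" where
  "round_pmf n = Pi_pmf (Pow {..<n}) undefined
     (\<lambda>U. pmf_of_set (Pow {..<n} \<times> {\<pi>. \<pi> permutes ({..<n} - U)}))"

lemma round_choices:
  "finite (Pow {..<n} \<times> {\<pi>. \<pi> permutes ({..<n::nat} - U)})" (is "finite ?C")
  "Pow {..<n} \<times> {\<pi>. \<pi> permutes ({..<n::nat} - U)} \<noteq> {}"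
proof -
  show "finite ?C" by (intro finite_cartesian_product finite_permutations) auto
  have "({}, id) \<in> ?C" using permutes_id by auto
  then show "?C \<noteq> {}" by blast
qed

lemma valid_choice_round_pmf:
  assumes "s \<in> set_pmf (round_pmf n)"
  shows "valid_choice n s"
proof -
  have "s U \<in> Pow {..<n} \<times> {\<pi>. \<pi> permutes ({..<n} - U)}" if "U \<subseteq> {..<n}" for U
  proof -
    have "s U \<in> set_pmf (pmf_of_set (Pow {..<n} \<times> {\<pi>. \<pi> permutes ({..<n} - U)}))"
      using assms that unfolding round_pmf_def by (subst (asm) set_Pi_pmf) (simp_all add: PiE_dflt_def)
    then show ?thesis by (simp only: set_pmf_of_set[OF round_choices(2) round_choices(1)])
  qed
  then show ?thesis unfolding valid_choice_def by (auto simp: mem_Times_iff)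
qed

lemma prob_round_pmf:
  assumes "U \<subseteq> {..<n}"
  shows "measure_pmf.prob (round_pmf n) {s. F (snd (s U) ` fst (s U)) \<noteq> F (fst (s U))}
    = (\<Sum>\<pi> | \<pi> permutes ({..<n} - U). real (sensitivity n F \<pi>))
        / (2 ^ n * real (card {\<pi>. \<pi> permutes ({..<n} - U)}))"
proof -
  let ?S = "{\<pi>. \<pi> permutes ({..<n} - U)}" and ?E = "{(X, \<pi>). F (\<pi> ` X) \<noteq> F X}"
  have fin: "finite ?S" by (intro finite_permutations) auto
  have "measure_pmf.prob (round_pmf n) {s. F (snd (s U) ` fst (s U)) \<noteq> F (fst (s U))}
      = measure_pmf.prob (map_pmf (\<lambda>s. s U) (round_pmf n)) ?E"
    by (simp add: vimage_def case_prod_unfold)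
  also have "map_pmf (\<lambda>s. s U) (round_pmf n) = pmf_of_set (Pow {..<n} \<times> ?S)"
    using assms unfolding round_pmf_def by (subst Pi_pmf_component) auto
  also have "measure_pmf.prob (pmf_of_set (Pow {..<n} \<times> ?S)) ?E
      = card ((Pow {..<n} \<times> ?S) \<inter> ?E) / card (Pow {..<n} \<times> ?S)"
    using round_choices by (intro measure_pmf_of_set) auto
  \<comment> \<open>Grouping the pairs by \<open>\<pi>\<close> turns the count into a sum of
    sensitivities.\<close>
  also have "card ((Pow {..<n} \<times> ?S) \<inter> ?E) = card (SIGMA \<pi>:?S. {X\<in>Pow {..<n}. F (\<pi> ` X) \<noteq> F X})"
    by (rule bij_betw_same_card[OF bij_betw_byWitness[where f = prod.swap and f' = prod.swap]]) auto
  also have "\<dots> = (\<Sum>\<pi>\<in>?S. sensitivity n F \<pi>)"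
    using fin by (subst card_SigmaI) (auto simp: sensitivity_def)
  finally show ?thesis by (simp add: card_cartesian_product card_Pow)
qed

text \<open>Each round finds a new block with probability at least \<open>c\<close>, and then halves the bound.\<close>
lemma tester_sound:
  assumes P: "valid_paths n k d W I B P" and B: "\<And>j. j \<in> I \<Longrightarrow> B j \<subseteq> {..<n}" and I: "finite I"
    and c: "0 \<le> c" "c \<le> 1"
    and sens: "\<And>D. D \<subseteq> I \<Longrightarrow> card D \<le> k \<Longrightarrow>
      c \<le> measure_pmf.prob (round_pmf n) {s. f (bits n (snd (s (\<Union>(B ` D))) ` fst (s (\<Union>(B ` D)))))
          \<noteq> f (bits n (fst (s (\<Union>(B ` D)))))}"
    and D: "D \<subseteq> I" "card D \<le> k"
  shows "measure_pmf.prob (replicate_pmf T (round_pmf n)) {ss. run f (tester n k d B P ss D)}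
    \<le> 2 ^ (k - card D) * (1 - c / 2) ^ T"
  using D
proof (induction T arbitrary: D)
  case 0
  have "measure_pmf.prob (replicate_pmf 0 (round_pmf n)) {ss. run f (tester n k d B P ss D)} \<le> 1" by simp
  also have "(1::real) \<le> 2 ^ (k - card D) * (1 - c / 2) ^ 0" by simp
  finally show ?case .
next
  case (Suc T)
  let ?p = "\<lambda>ts D. measure_pmf.prob (replicate_pmf T (round_pmf n)) {ss. run f (tester n k d B P (ts @ ss) D)}"
  let ?E = "{s. f (bits n (snd (s (\<Union>(B ` D))) ` fst (s (\<Union>(B ` D))))) \<noteq> f (bits n (fst (s (\<Union>(B ` D)))))}"
  define Q where "Q = 2 ^ (k - card D) * (1 - c / 2) ^ T"
  have Q: "0 \<le> Q" using c by (simp add: Q_def)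
  have step: "?p [s] D \<le> Q - Q / 2 * indicator ?E s" if s: "s \<in> set_pmf (round_pmf n)" for s
  proof (cases "s \<in> ?E")
    case False
    then have "?p [s] D = ?p [] D" using Suc.prems by (simp add: Let_def)
    also have "\<dots> \<le> Q" unfolding Q_def using Suc by simp
    finally show ?thesis using False by simp
  next
    case True
    obtain j where j: "j \<in> I - D"
      "\<And>ss. run f (tester n k d B P (s # ss) D) = run f (tester n k d B P ss (insert j D))"
      using run_tester_step[OF P valid_choice_round_pmf[OF s] Suc.prems B] True by blast
    have cD: "card (insert j D) = Suc (card D)"
      using j(1) Suc.prems(1) I finite_subset by (subst card_insert_disjoint) auto
    have "?p [s] D = ?p [] (insert j D)" using j(2) by simp
    also have "\<dots> \<le> Q / 2"
    \<comment> \<open>With \<open>k\<close> blocks known, one more forces rejection; below that, the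
      exponent \<open>k - card D\<close> drops by one.\<close>
    proof (cases "card D = k")
      case True
      then have "?p [] (insert j D) = 0" using not_run_tester[of k "insert j D"] cD by simp
      then show ?thesis using Q by simp
    next
      case False
      then have "?p [] (insert j D) \<le> 2 ^ (k - Suc (card D)) * (1 - c / 2) ^ T"
        using Suc.IH[of "insert j D"] cD j(1) Suc.prems by simp
      also have "\<dots> = Q / 2"
        using False Suc.prems(2) by (simp add: Q_def Suc_diff_Suc[symmetric])
      finally show ?thesis .
    qed
    finally show ?thesis using True by simp
  qed
  have int_E: "integrable (measure_pmf (round_pmf n)) (\<lambda>s. Q / 2 * indicator ?E s)"
    by (intro integrable_mult_right
        measure_pmf.integrable_const_bound[where B = 1 and f = "indicator ?E"]) auto
  have "measure_pmf.prob (replicate_pmf (Suc T) (round_pmf n)) {ss. run f (tester n k d B P ss D)}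
      = (\<integral>s. ?p [s] D \<partial>measure_pmf (round_pmf n))"
    by (simp add: prob_bind_pmf vimage_def map_pmf_def[symmetric] del: tester.simps)
  also have "\<dots> \<le> (\<integral>s. Q - Q / 2 * indicator ?E s \<partial>measure_pmf (round_pmf n))"
  proof (rule integral_mono_AE)
    show "integrable (measure_pmf (round_pmf n)) (\<lambda>s. ?p [s] D)"
      by (rule measure_pmf.integrable_const_bound[where B = 1]) (simp_all del: tester.simps)
    show "integrable (measure_pmf (round_pmf n)) (\<lambda>s. Q - Q / 2 * indicator ?E s)"
      using int_E by (intro Bochner_Integration.integrable_diff) auto
    show "AE s in measure_pmf (round_pmf n). ?p [s] D \<le> Q - Q / 2 * indicator ?E s"
      unfolding AE_measure_pmf_iff using step by blast
  qed
  also have "\<dots> = Q - Q / 2 * measure_pmf.prob (round_pmf n) ?E"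
    by (subst Bochner_Integration.integral_diff[OF _ int_E]) auto
  also have "\<dots> \<le> Q - Q / 2 * c"
    using sens[OF Suc.prems] Q by (intro diff_left_mono mult_left_mono) auto
  also have "\<dots> = 2 ^ (k - card D) * (1 - c / 2) ^ Suc T" by (simp add: Q_def algebra_simps)
  finally show ?case .
qed

section \<open>Blocks and workspaces\<close>

text \<open>There are \<open>3 * k\<close> disjoint candidates, and at most \<open>k\<close> of them
  can contain one of \<open>k\<close> asymmetric coordinates.\<close>

definition workspace :: "nat \<Rightarrow> nat \<Rightarrow> nat \<Rightarrow> nat set" where
  "workspace n k i = {i * (n div (3 * k))..<(i + 1) * (n div (3 * k))}"

definition block_size :: "nat \<Rightarrow> nat \<Rightarrow> nat" where
  "block_size n k = max 1 (n div (100 * k))"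

text \<open>Colour classes cut by intervals: the intervals keep blocks small, and \<open>k\<close>
  blocks still use at most \<open>k\<close> colours.\<close>

definition block :: "nat \<Rightarrow> nat \<Rightarrow> nat \<Rightarrow> (nat \<Rightarrow> nat) \<Rightarrow> nat \<times> nat \<Rightarrow> nat set" where
  "block n k i h j = {x\<in>{..<n} - workspace n k i. h x = fst j \<and> x div block_size n k = snd j}"

text \<open>The extra interval index covers an incomplete last interval.\<close>

definition block_index :: "nat \<Rightarrow> nat \<Rightarrow> (nat \<times> nat) set" where
  "block_index n k = {..<640 * k\<^sup>2} \<times> {..<n div block_size n k + 1}"

lemma finite_block_index: "finite (block_index n k)"
  by (simp add: block_index_def)

lemma block_subset: "block n k i h j \<subseteq> {..<n}"
  by (auto simp: block_def)

lemma disjoint_blocks: "disjoint_family_on (block n k i h) I"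
  by (auto simp: disjoint_family_on_def block_def)

lemma card_block_le: "card (block n k i h j) \<le> block_size n k"
proof -
  have pos: "0 < block_size n k" by (simp add: block_size_def)
  have "block n k i h j \<subseteq> {snd j * block_size n k..<snd j * block_size n k + block_size n k}"
  proof
    fix x assume "x \<in> block n k i h j"
    then have "x div block_size n k = snd j" by (simp add: block_def)
    then show "x \<in> {snd j * block_size n k..<snd j * block_size n k + block_size n k}"
      using div_mult_mod_eq[of x "block_size n k"] mod_less_divisor[OF pos, of x] by simp
  qed
  then have "card (block n k i h j) \<le> card {snd j * block_size n k..<snd j * block_size n k + block_size n k}"
    by (intro card_mono) auto
  then show ?thesis by simp
qed

lemma workspace_subset:
  assumes "i < 3 * k"
  shows "workspace n k i \<subseteq> {..<n}"
proof -
  have "(i + 1) * (n div (3 * k)) \<le> (3 * k) * (n div (3 * k))" using assms by (intro mult_right_mono) auto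
  also have "\<dots> \<le> n" by simp
  finally show ?thesis by (auto simp: workspace_def)
qed

lemma disjoint_workspaces: "disjoint_family_on (workspace n k) I"
proof -
  have "i = j" if "x \<in> workspace n k i" "x \<in> workspace n k j" for i j x
  proof -
    have "x div (n div (3 * k)) = m" if "x \<in> workspace n k m" for m
      using that by (intro div_nat_eqI) (auto simp: workspace_def mult.commute)
    then show ?thesis using that by blast
  qed
  then show ?thesis unfolding disjoint_family_on_def by blast
qed

lemma block_size_le_workspace:
  assumes "1 \<le> k" "10 * k < n"
  shows "2 * block_size n k \<le> card (workspace n k i) + 1"
proof -
  have c: "card (workspace n k i) = n div (3 * k)" by (simp add: workspace_def)
  have "1 \<le> n div (3 * k)" using assms by (simp add: Suc_le_eq div_greater_zero_iff)
  moreover have "2 * (n div (100 * k)) \<le> n div (3 * k)"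
  proof -
    have "2 * (n div (100 * k)) * (3 * k) \<le> n div (100 * k) * (100 * k)" by simp
    also have "\<dots> \<le> n" by simp
    finally show ?thesis using assms by (simp add: less_eq_div_iff_mult_less_eq)
  qed
  ultimately show ?thesis unfolding c block_size_def by linarith
qed

lemma blocks_cover:
  assumes "h \<in> {..<n} \<rightarrow> {..<640 * k\<^sup>2}"
  shows "{..<n} \<subseteq> workspace n k i \<union> \<Union>(block n k i h ` block_index n k)"
proof
  fix x assume x: "x \<in> {..<n}"
  have "x div block_size n k \<le> n div block_size n k" using x by (intro div_le_mono) simp
  then have "(h x, x div block_size n k) \<in> block_index n k"
    using assms x by (auto simp: block_index_def)
  then show "x \<in> workspace n k i \<union> \<Union>(block n k i h ` block_index n k)"
    using x by (cases "x \<in> workspace n k i") (auto simp: block_def intro!: bexI[of _ "(h x, x div block_size n k)"])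
qed

lemma card_block_index:
  assumes "1 \<le> k"
  shows "k < card (block_index n k)" "card (block_index n k) \<le> 2 ^ 17 * k ^ 3"
proof -
  have c: "card (block_index n k) = 640 * k\<^sup>2 * (n div block_size n k + 1)"
    by (simp add: block_index_def card_cartesian_product)
  have "k < 640 * k\<^sup>2" using assms by (simp add: power2_eq_square)
  also have "\<dots> \<le> card (block_index n k)" unfolding c by simp
  finally show "k < card (block_index n k)" .
  have "n div block_size n k \<le> 200 * k"
  proof (cases "n div (100 * k) \<le> 1")
    case True
    then have "n div (100 * k) < 2" by simp
    then have "n < 200 * k" using assms by (simp add: div_less_iff_less_mult)
    then show ?thesis using True by (simp add: block_size_def)
  next
    case False
    \<comment> \<open>Rounding down loses at most a factor 2, as the quotient is at least 2.\<close>
    have "n < (n div (100 * k) + 1) * (100 * k)" using assms dividend_less_div_times[of "100 * k" n] by simp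
    also have "\<dots> \<le> (2 * (n div (100 * k))) * (100 * k)" using False by (intro mult_right_mono) auto
    also have "\<dots> = (200 * k) * block_size n k" using False by (simp add: block_size_def)
    finally show ?thesis using less_mult_imp_div_less[of n "200 * k" "block_size n k"] by simp
  qed
  then have "n div block_size n k + 1 \<le> 201 * k" using assms by linarith
  then have "card (block_index n k) \<le> 640 * k\<^sup>2 * (201 * k)" unfolding c by (intro mult_left_mono) auto
  also have "\<dots> = 128640 * k ^ 3" by (simp add: power2_eq_square power3_eq_cube)
  \<comment> \<open>\<open>128640 \<le> 131072 = 2 ^ 17\<close>; a power of two is convenient for
    the search depth.\<close>
  also have "\<dots> \<le> 2 ^ 17 * k ^ 3" by (intro mult_right_mono) simp_all
  finally show "card (block_index n k) \<le> 2 ^ 17 * k ^ 3" .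
qed

text \<open>When \<open>n < 200 * k\<close> the blocks are single points and no randomness is needed.\<close>
lemma blocks_not_nearly_symmetric:
  fixes F :: "nat set \<Rightarrow> bool"
  assumes k: "1 \<le> k"
    and far: "\<And>D. D \<subseteq> {..<n} \<Longrightarrow> card D \<le> k \<Longrightarrow> \<not> nearly_symmetric n F (9 * \<delta>) D"
  obtains good where
    "9 / 10 \<le> measure_pmf.prob (Pi_pmf {..<n} (640 * k\<^sup>2) (\<lambda>_. pmf_of_set {..<640 * k\<^sup>2})) good"
    "\<And>h i D. h \<in> good \<Longrightarrow> D \<subseteq> block_index n k \<Longrightarrow> card D \<le> k \<Longrightarrow>
       \<not> nearly_symmetric n F \<delta> (\<Union>(block n k i h ` D))"
proof -
  let ?H = "Pi_pmf {..<n} (640 * k\<^sup>2) (\<lambda>_. pmf_of_set {..<640 * k\<^sup>2})"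
  have U: "\<Union>(block n k i h ` D) \<subseteq> {..<n}" "card (\<Union>(block n k i h ` D)) \<le> k * block_size n k"
    if "D \<subseteq> block_index n k" "card D \<le> k" for i h D
  proof -
    show "\<Union>(block n k i h ` D) \<subseteq> {..<n}" using block_subset by blast
    have "finite D" using that(1) finite_block_index finite_subset by blast
    then have "card (\<Union>(block n k i h ` D)) \<le> (\<Sum>j\<in>D. card (block n k i h j))" by (rule card_UN_le)
    also have "\<dots> \<le> (\<Sum>j\<in>D. block_size n k)" by (intro sum_mono card_block_le)
    also have "\<dots> \<le> k * block_size n k" using that(2) by simp
    finally show "card (\<Union>(block n k i h ` D)) \<le> k * block_size n k" .
  qed
  show thesis
  proof (cases "200 * k \<le> n")
    case True
    let ?bad = "{h. \<exists>D K. D \<subseteq> {..<n} \<and> 10 * card D \<le> n \<and> K \<subseteq> {..<640 * k\<^sup>2} \<and> card K = k \<and> h ` D \<subseteq> K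
        \<and> nearly_symmetric n F \<delta> D}"
    have "2 \<le> n div (100 * k)" using True k by (simp add: less_eq_div_iff_mult_less_eq)
    then have "10 * (k * block_size n k) \<le> (100 * k) * (n div (100 * k))" by (simp add: block_size_def)
    also have "\<dots> \<le> n" by (rule times_div_less_eq_dividend)
    finally have small: "10 * (k * block_size n k) \<le> n" .
    have "measure_pmf.prob ?H (- ?bad) = 1 - measure_pmf.prob ?H ?bad"
      using measure_pmf.prob_compl[of ?bad ?H] by (simp add: Compl_eq_Diff_UNIV)
    then have "9 / 10 \<le> measure_pmf.prob ?H (- ?bad)"
      using random_colouring[OF k True refl, of F \<delta>] far by force
    moreover have "\<not> nearly_symmetric n F \<delta> (\<Union>(block n k i h ` D))"
      if h: "h \<in> - ?bad" and D: "D \<subseteq> block_index n k" "card D \<le> k" for h i D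
    proof
      assume near: "nearly_symmetric n F \<delta> (\<Union>(block n k i h ` D))"
      have finD: "finite D" using D(1) finite_block_index finite_subset by blast
      have "fst ` D \<subseteq> {..<640 * k\<^sup>2}" using D(1) by (auto simp: block_index_def)
      moreover have "card (fst ` D) \<le> k" using card_image_le[OF finD, of fst] D(2) by simp
      moreover have "k \<le> card {..<640 * k\<^sup>2}" by (simp add: power2_eq_square)
      \<comment> \<open>Several blocks may share a colour, so the colours of \<open>D\<close> are
        padded to exactly \<open>k\<close>.\<close>
      ultimately obtain K where K: "fst ` D \<subseteq> K" "K \<subseteq> {..<640 * k\<^sup>2}" "card K = k"
        using exists_subset_between[of "fst ` D" k "{..<640 * k\<^sup>2}"] by auto
      have "h ` \<Union>(block n k i h ` D) \<subseteq> K" using K(1) by (auto simp: block_def)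
      moreover have "10 * card (\<Union>(block n k i h ` D)) \<le> n" using U(2)[OF D, of i h] small by linarith
      ultimately show False using h near U(1)[OF D, of i h] K by blast
    qed
    ultimately show thesis by (rule that)
  next
    case False
    then have "n div (100 * k) < 2" using k by (simp add: div_less_iff_less_mult)
    then have "block_size n k = 1" by (simp add: block_size_def)
    then have "\<not> nearly_symmetric n F \<delta> (\<Union>(block n k i h ` D))"
      if "D \<subseteq> block_index n k" "card D \<le> k" for h i D
      using far[of "\<Union>(block n k i h ` D)"] U[OF that, of i h]
        nearly_symmetric_mono[of n F \<delta> "\<Union>(block n k i h ` D)" "9 * \<delta>"]
        nearly_symmetric_nonneg[of n F \<delta> "\<Union>(block n k i h ` D)"] by auto
    then show thesis by (intro that[of UNIV]) auto
  qed
qed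

text \<open>Some permutation has sensitivity at least \<open>c * 2 * 2 ^ n\<close>; the average,
  which governs the round, is at least half of that.\<close>

lemma round_detects:
  assumes "U \<subseteq> {..<n}" "\<not> nearly_symmetric n F (c * 2 * 2 ^ n) U"
  shows "c \<le> measure_pmf.prob (round_pmf n) {s. F (snd (s U) ` fst (s U)) \<noteq> F (fst (s U))}"
proof -
  let ?S = "{\<pi>. \<pi> permutes ({..<n} - U)}"
  have "?S \<noteq> {}" "finite ?S" using round_choices[of n U] finite_permutations[of "{..<n} - U"] by auto
  then have pos: "0 < card ?S" by (simp add: card_gt_0_iff)
  obtain \<sigma> where \<sigma>: "\<sigma> permutes ({..<n} - U)" "c * 2 * 2 ^ n \<le> real (sensitivity n F \<sigma>)"
    using assms(2) by (force simp: nearly_symmetric_def)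
  have "c * 2 * 2 ^ n * real (card ?S) \<le> real (sensitivity n F \<sigma> * card ?S)"
    using \<sigma>(2) by (simp add: mult_right_mono)
  also have "\<dots> \<le> real (2 * (\<Sum>\<pi>\<in>?S. sensitivity n F \<pi>))"
    using sensitivity_le_average[OF _ \<sigma>(1), of n F] by (intro of_nat_mono) auto
  finally show ?thesis using pos unfolding prob_round_pmf[OF assms(1)] by (simp add: field_simps)
qed

text \<open>By majority rounding the average sensitivity is at least
  \<open>\<epsilon> / 2 * 2 ^ n\<close>, so not all values lie strictly below it.\<close>

lemma far_not_nearly_symmetric:
  assumes "far_from_t_symmetric n (n - k) \<epsilon> f" "D \<subseteq> {..<n}" "card D \<le> k"
  shows "\<not> nearly_symmetric n (f \<circ> bits n) (\<epsilon> / 2 * 2 ^ n) D"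
proof
  assume near: "nearly_symmetric n (f \<circ> bits n) (\<epsilon> / 2 * 2 ^ n) D"
  let ?S = "{\<pi>. \<pi> permutes ({..<n} - D)}"
  have S: "?S \<noteq> {}" "finite ?S" using round_choices[of n D] finite_permutations[of "{..<n} - D"] by auto
  have "n - k \<le> card ({..<n} - D)" using assms(2,3) finite_subset[OF assms(2)] by (simp add: card_Diff_subset)
  then have "\<epsilon> / 2 * 2 ^ n * real (card ?S) \<le> (\<Sum>\<pi>\<in>?S. real (sensitivity n (f \<circ> bits n) \<pi>))"
    by (intro far_imp_average_sensitivity[OF assms(1)]) auto
  also have "\<dots> < (\<Sum>\<pi>\<in>?S. \<epsilon> / 2 * 2 ^ n)"
    using S near by (intro sum_strict_mono) (auto simp: nearly_symmetric_def)
  finally show False by (simp add: mult.commute)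
qed

section \<open>The query bound\<close>

text \<open>The power is at most \<open>exp (- \<epsilon> * T / 72)\<close>, and
  \<open>288 = 4 * 72\<close> makes this at most \<open>exp (- 4 * k) \<le> (1 / 16) ^ k\<close>,
  which outweighs \<open>2 ^ k\<close>.\<close>

lemma round_count_suffices:
  fixes k T :: nat and \<epsilon> :: real
  assumes "1 \<le> k" "0 < \<epsilon>" "\<epsilon> \<le> 1" "288 * k \<le> \<epsilon> * T"
  shows "2 ^ k * (1 - \<epsilon> / 36 / 2) ^ T \<le> 1 / 8"
proof -
  have "2 * 2 * 2 * 2 \<le> exp 1 * exp 1 * exp 1 * exp (1::real)"
    using exp_ge_add_one_self[of 1] by (intro mult_mono) auto
  then have e4: "16 \<le> exp (4::real)" by (simp flip: exp_add)
  have "(1 - \<epsilon> / 36 / 2) ^ T \<le> exp (- \<epsilon> / 72) ^ T"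
    using assms exp_ge_add_one_self[of "- \<epsilon> / 72"] by (intro power_mono) auto
  also have "\<dots> = exp (- (\<epsilon> * T) / 72)" by (simp flip: exp_of_nat_mult add: mult.commute)
  also have "\<dots> \<le> exp (of_nat k * (- 4))" using assms(4) by simp
  also have "\<dots> = (1 / exp 4) ^ k" by (subst exp_of_nat_mult) (simp add: exp_minus field_simps)
  also have "\<dots> \<le> (1 / 16) ^ k" using e4 by (intro power_mono) (auto simp: field_simps)
  finally have "2 ^ k * (1 - \<epsilon> / 36 / 2) ^ T \<le> 2 ^ k * (1 / 16) ^ k" by simp
  also have "\<dots> = (1 / 8) ^ k" by (simp flip: power_mult_distrib)
  also have "\<dots> \<le> (1 / 8) ^ 1" using assms(1) by (intro power_decreasing) auto
  finally show ?thesis by simp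
qed

section \<open>Assembling the randomized tester\<close>

lemma tester_pmf:
  fixes n k :: nat and \<epsilon> :: real
  assumes k: "1 \<le> k" "10 * k < n" and \<epsilon>: "0 < \<epsilon>" "\<epsilon> \<le> 1"
    and d: "2 ^ 17 * k ^ 3 \<le> 2 ^ d" and T: "288 * k \<le> \<epsilon> * T"
  shows "\<exists>A :: qtree pmf.
    (\<forall>t\<in>set_pmf A. queries_in n t \<and> depth t \<le> T * (d + 2)) \<and>
    (\<forall>f. t_symmetric n (n - k) f \<longrightarrow> measure_pmf.prob A {t. run f t} \<ge> 2/3) \<and>
    (\<forall>f. far_from_t_symmetric n (n - k) \<epsilon> f \<longrightarrow> measure_pmf.prob A {t. \<not> run f t} \<ge> 2/3)"
proof -
  let ?r = "640 * k\<^sup>2"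
  let ?I = "block_index n k"
  define H where "H = Pi_pmf {..<n} ?r (\<lambda>_. pmf_of_set {..<?r})"
  define P where "P i h = (SOME P. valid_paths n k d (workspace n k i) ?I (block n k i h) P)" for i h
  define W where "W = pmf_of_set {..<3 * k}"
  have ne_W: "{..<3 * k} \<noteq> {}" using k by (simp add: lessThan_empty_iff)
  then have set_W: "set_pmf W = {..<3 * k}" by (simp add: W_def)
  have P: "valid_paths n k d (workspace n k i) ?I (block n k i h) (P i h)"
    if "i \<in> set_pmf W" "h \<in> set_pmf H" for i h
  proof -
    have "{..<?r} \<noteq> {}" using k by (simp add: lessThan_empty_iff)
    then have "set_pmf (pmf_of_set {..<?r}) = {..<?r}" by simp
    then have h: "h \<in> {..<n} \<rightarrow> {..<?r}"
      using that(2) unfolding H_def by (subst (asm) set_Pi_pmf) (auto simp: PiE_dflt_def)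
    have i: "i < 3 * k" using that(1) set_W by simp
    have I: "card ?I \<le> 2 ^ d" using card_block_index(2)[OF k(1)] d by (rule order_trans)
    have B: "block n k i h j \<subseteq> {..<n} \<and> card (block n k i h j) \<le> block_size n k
        \<and> block n k i h j \<inter> workspace n k i = {}" for j
      using block_subset card_block_le by (auto simp: block_def)
    obtain P' where "valid_paths n k d (workspace n k i) ?I (block n k i h) P'"
      by (rule ex_valid_paths[OF workspace_subset[OF i] finite_block_index card_block_index(1)[OF k(1)] I B
            blocks_cover[OF h] disjoint_blocks block_size_le_workspace[OF k]])
    then show ?thesis unfolding P_def
      by (rule someI[where P = "valid_paths n k d (workspace n k i) ?I (block n k i h)"])
  qed
  define R where "R i h = map_pmf (\<lambda>ss. tester n k d (block n k i h) (P i h) ss {})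
      (replicate_pmf T (round_pmf n))" for i h
  define A where "A = bind_pmf W (\<lambda>i. bind_pmf H (R i))"
  have prob_A: "measure_pmf.prob A X = (\<integral>i. (\<integral>h. measure_pmf.prob (R i h) X \<partial>measure_pmf H) \<partial>measure_pmf W)"
    for X by (simp add: A_def prob_bind_pmf)
  have bounded: "integrable (measure_pmf M) g" if "\<And>x. 0 \<le> g x \<and> g x \<le> 1" for M :: "'b pmf" and g :: "'b \<Rightarrow> real"
    using that by (intro measure_pmf.integrable_const_bound[where B = 1]) auto
  have unit: "0 \<le> (\<integral>h. measure_pmf.prob (R i h) X \<partial>measure_pmf H) \<and>
      (\<integral>h. measure_pmf.prob (R i h) X \<partial>measure_pmf H) \<le> 1" for i X
    by (auto intro!: integral_nonneg measure_pmf.integral_le_const bounded)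
  have "queries_in n t \<and> depth t \<le> T * (d + 2)" if "t \<in> set_pmf A" for t
    using that depth_tester by (fastforce simp: A_def R_def queries_in_tester set_replicate_pmf)
  moreover have "2 / 3 \<le> measure_pmf.prob A {t. run f t}" if f: "t_symmetric n (n - k) f" for f
  proof -
    obtain J where J: "J \<subseteq> {..<n}" "n - k \<le> card J" "J_symmetric n J f"
      using f unfolding t_symmetric_def by blast
    have cJ: "card ({..<n} - J) \<le> k"
      using J finite_subset[OF J(1)] by (simp add: card_Diff_subset)
    let ?G = "{i. workspace n k i \<subseteq> J}"
    have "card ({..<3 * k} - ?G) \<le> card ({..<n} - J)"
      by (rule card_blocks_meeting[OF disjoint_workspaces, where I = UNIV])
        (use workspace_subset in auto)
    moreover have "3 * k = card ({..<3 * k} \<inter> ?G) + card ({..<3 * k} - ?G)"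
      using card_Int_Diff[of "{..<3 * k}" ?G] by simp
    ultimately have "2 * k \<le> card ({..<3 * k} \<inter> ?G)" using cJ by linarith
    then have "2 / 3 \<le> measure_pmf.prob W ?G"
      unfolding W_def using k ne_W by (subst measure_pmf_of_set) (auto simp: field_simps)
    also have "\<dots> = (\<integral>i. indicator ?G i \<partial>measure_pmf W)" by simp
    also have "\<dots> \<le> measure_pmf.prob A {t. run f t}"
      unfolding prob_A
    proof (rule integral_mono_AE)
      have "(\<integral>h. measure_pmf.prob (R i h) {t. run f t} \<partial>measure_pmf H) = 1"
        if i: "i \<in> set_pmf W" "i \<in> ?G" for i
      proof -
        have "measure_pmf.prob (R i h) {t. run f t} = 1" if h: "h \<in> set_pmf H" for h
        proof -
          have "run f (tester n k d (block n k i h) (P i h) ss {})"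
            if "ss \<in> set_pmf (replicate_pmf T (round_pmf n))" for ss
          proof (rule tester_complete[OF J(3,1) cJ _ P[OF i(1) h] block_subset disjoint_blocks])
            show "workspace n k i \<subseteq> J" using i(2) by simp
            show "valid_choice n s" if "s \<in> set ss" for s
              using that \<open>ss \<in> _\<close> by (auto simp: set_replicate_pmf intro: valid_choice_round_pmf)
          qed simp
          then have "set_pmf (R i h) \<subseteq> {t. run f t}" by (auto simp: R_def)
          then show ?thesis by (simp add: measure_pmf.prob_eq_1 AE_measure_pmf_iff subset_iff)
        qed
        then have "(\<integral>h. measure_pmf.prob (R i h) {t. run f t} \<partial>measure_pmf H) = (\<integral>h. 1 \<partial>measure_pmf H)"
          by (intro integral_cong_AE) (auto simp: AE_measure_pmf_iff)
        then show ?thesis by simp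
      qed
      then show "AE i in measure_pmf W. indicator ?G i
          \<le> (\<integral>h. measure_pmf.prob (R i h) {t. run f t} \<partial>measure_pmf H)"
        using unit by (auto simp: AE_measure_pmf_iff split: split_indicator)
    qed (use unit in \<open>auto intro!: bounded split: split_indicator\<close>)
    finally show ?thesis .
  qed
  moreover have "2 / 3 \<le> measure_pmf.prob A {t. \<not> run f t}"
    if f: "far_from_t_symmetric n (n - k) \<epsilon> f" for f
  proof -
    \<comment> \<open>Two intersections cost a factor 3 each, and \<open>9 * \<delta>\<close> is the
      bound \<open>\<epsilon> / 2 * 2 ^ n\<close> supplied by the distance; the form fits
      \<open>round_detects\<close> with \<open>c = \<epsilon> / 36\<close>.\<close>
    define \<delta> where "\<delta> = \<epsilon> / 36 * 2 * 2 ^ n"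
    have "\<not> nearly_symmetric n (f \<circ> bits n) (9 * \<delta>) D" if "D \<subseteq> {..<n}" "card D \<le> k" for D
      using far_not_nearly_symmetric[OF f that] by (simp add: \<delta>_def)
    then obtain good where good: "9 / 10 \<le> measure_pmf.prob H good"
      "\<And>h i D. h \<in> good \<Longrightarrow> D \<subseteq> ?I \<Longrightarrow> card D \<le> k \<Longrightarrow>
         \<not> nearly_symmetric n (f \<circ> bits n) \<delta> (\<Union>(block n k i h ` D))"
      unfolding H_def using blocks_not_nearly_symmetric[OF k(1), of n "f \<circ> bits n" \<delta>] by metis
    have reject: "7 / 8 \<le> measure_pmf.prob (R i h) {t. \<not> run f t}"
      if i: "i \<in> set_pmf W" and h: "h \<in> set_pmf H" "h \<in> good" for i h
    proof -
      let ?B = "block n k i h"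
      have sens: "\<epsilon> / 36 \<le> measure_pmf.prob (round_pmf n) {s. f (bits n (snd (s (\<Union>(?B ` D))) ` fst (s (\<Union>(?B ` D)))))
          \<noteq> f (bits n (fst (s (\<Union>(?B ` D)))))}" if "D \<subseteq> ?I" "card D \<le> k" for D
        using round_detects[of "\<Union>(?B ` D)" n "f \<circ> bits n" "\<epsilon> / 36"] block_subset good(2)[OF h(2) that]
        by (force simp: \<delta>_def)
      have "measure_pmf.prob (replicate_pmf T (round_pmf n)) {ss. run f (tester n k d ?B (P i h) ss {})}
          \<le> 2 ^ (k - card ({} :: (nat \<times> nat) set)) * (1 - \<epsilon> / 36 / 2) ^ T"
        by (rule tester_sound[OF P[OF i h(1)] block_subset finite_block_index _ _ sens]) (use \<epsilon> in auto)
      also have "\<dots> \<le> 1 / 8" using round_count_suffices[OF k(1) \<epsilon> T] by simp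
      finally have "measure_pmf.prob (R i h) {t. run f t} \<le> 1 / 8" by (simp add: R_def vimage_def)
      moreover have "measure_pmf.prob (R i h) (- {t. run f t}) = 1 - measure_pmf.prob (R i h) {t. run f t}"
        using measure_pmf.prob_compl[of "{t. run f t}" "R i h"] by (simp add: Compl_eq_Diff_UNIV)
      ultimately show ?thesis by (simp add: Collect_neg_eq)
    qed
    \<comment> \<open>A good colouring has probability \<open>9 / 10\<close>, and then rejection has
      probability \<open>7 / 8\<close>.\<close>
    have "63 / 80 \<le> (\<integral>h. measure_pmf.prob (R i h) {t. \<not> run f t} \<partial>measure_pmf H)" if i: "i \<in> set_pmf W" for i
    proof -
      have "63 / 80 \<le> 7 / 8 * measure_pmf.prob H good" using good(1) by simp
      also have "\<dots> = (\<integral>h. 7 / 8 * indicator good h \<partial>measure_pmf H)" by simp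
      also have "\<dots> \<le> (\<integral>h. measure_pmf.prob (R i h) {t. \<not> run f t} \<partial>measure_pmf H)"
      proof (rule integral_mono_AE)
        show "AE h in measure_pmf H. 7 / 8 * indicator good h \<le> measure_pmf.prob (R i h) {t. \<not> run f t}"
          using reject[OF i] by (auto simp: AE_measure_pmf_iff split: split_indicator)
      qed (auto intro!: bounded split: split_indicator)
      finally show ?thesis .
    qed
    then have "63 / 80 \<le> measure_pmf.prob A {t. \<not> run f t}"
      unfolding prob_A by (intro measure_pmf.integral_ge_const bounded unit) (auto simp: AE_measure_pmf_iff)
    then show ?thesis by simp
  qed
  ultimately show ?thesis by blast
qed

text \<open>For \<open>x \<le> 3\<close> the left side is at most 9, while \<open>x * ln x\<close>
  may vanish; beyond 3 the logarithm is at least 1 and absorbs the summand \<open>x\<close>.\<close>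

lemma query_count_bound:
  fixes x :: real
  assumes "1 \<le> x"
  shows "x * (1 + ln x) \<le> 9 * max 1 (x * ln x)"
proof (cases "x \<le> 3")
  case True
  have "ln x \<le> 2" using ln_le_minus_one[of x] assms True by simp
  then have "x * (1 + ln x) \<le> 3 * 3" using assms True by (intro mult_mono) auto
  then show ?thesis by simp
next
  case False
  have "ln (exp 1) \<le> ln x" using False exp_le assms by (subst ln_le_cancel_iff) auto
  then have "x \<le> x * ln x" using assms by simp
  then have "x * (1 + ln x) \<le> 9 * (x * ln x)" using assms by (simp add: distrib_left)
  also have "\<dots> \<le> 9 * max 1 (x * ln x)" by simp
  finally show ?thesis .
qed

theorem theorem2:
  shows "\<exists>C>0. \<forall>(n::nat) (k::nat) (\<epsilon>::real).
    1 \<le> k \<longrightarrow> real k < real n / 10 \<longrightarrow> \<epsilon> > 0 \<longrightarrow>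
    (\<exists>A :: qtree pmf.
       (\<forall>T\<in>set_pmf A. queries_in n T \<and>
          real (depth T) \<le> C * max 1 ((real k / \<epsilon>) * ln (real k / \<epsilon>))) \<and>
       (\<forall>f. t_symmetric n (n - k) f \<longrightarrow>
          measure_pmf.prob A {T. run f T} \<ge> 2/3) \<and>
       (\<forall>f. far_from_t_symmetric n (n - k) \<epsilon> f \<longrightarrow>
          measure_pmf.prob A {T. \<not> run f T} \<ge> 2/3))"
proof (intro exI[of _ "289 * 22 * 9 :: real"] conjI allI impI)
  \<comment> \<open>The constant collects at most \<open>289 * x\<close> rounds with at most
    \<open>22 * (1 + ln x)\<close> queries each, for \<open>x = k / \<epsilon>\<close>, and the
    factor 9 of \<open>query_count_bound\<close>.\<close>
  fix n k :: nat and \<epsilon> :: real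
  assume k: "1 \<le> k" "real k < real n / 10" and \<epsilon>: "0 < \<epsilon>"
  show "\<exists>A :: qtree pmf.
       (\<forall>T\<in>set_pmf A. queries_in n T \<and>
          real (depth T) \<le> 289 * 22 * 9 * max 1 ((real k / \<epsilon>) * ln (real k / \<epsilon>))) \<and>
       (\<forall>f. t_symmetric n (n - k) f \<longrightarrow>
          measure_pmf.prob A {T. run f T} \<ge> 2/3) \<and>
       (\<forall>f. far_from_t_symmetric n (n - k) \<epsilon> f \<longrightarrow>
          measure_pmf.prob A {T. \<not> run f T} \<ge> 2/3)"
  proof (cases "\<epsilon> \<le> 1")
    \<comment> \<open>No function is this far: a constant function is symmetric and at distance at
      most 1, so always accepting is correct.\<close>
    case False
    have "\<not> far_from_t_symmetric n (n - k) \<epsilon> f" for f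
    proof
      assume far: "far_from_t_symmetric n (n - k) \<epsilon> f"
      have "t_symmetric n (n - k) (\<lambda>_. True)"
        unfolding t_symmetric_def J_symmetric_def by (intro exI[of _ "{..<n}"]) auto
      then have "\<epsilon> \<le> fdist n f (\<lambda>_. True)" using far unfolding far_from_t_symmetric_def by blast
      moreover have "fdist n f (\<lambda>_. True) \<le> 1"
      proof -
        have "finite (cube n)" "card (cube n) = 2 ^ n"
          using bij_betw_bits[of n] bij_betw_finite bij_betw_same_card by (fastforce simp: card_Pow)+
        then have "card {x\<in>cube n. f x \<noteq> True} \<le> 2 ^ n" by (metis (no_types, lifting) card_mono mem_Collect_eq subsetI)
        then have "real (card {x\<in>cube n. f x \<noteq> True}) \<le> real (2 ^ n)" by (rule of_nat_mono)
        then show ?thesis by (simp add: fdist_def)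
      qed
      ultimately show False using False by simp
    qed
    then show ?thesis by (intro exI[of _ "return_pmf (Leaf True)"]) (auto simp: indicator_def)
  next
    case True
    define x where "x = real k / \<epsilon>"
    have x: "1 \<le> x" "real k \<le> x" using k True \<epsilon> by (auto simp: x_def field_simps mult_left_le)
    define T where "T = nat \<lceil>288 * x\<rceil>"
    \<comment> \<open>Chosen so that \<open>2 ^ d\<close> exceeds or equals the bound
      \<open>2 ^ 17 * k ^ 3\<close> on the number of blocks.\<close>
    define d where "d = 17 + 3 * nat \<lceil>log 2 k\<rceil>"
    have T: "288 * x \<le> T" "T \<le> 289 * x"
      using x(1) by (auto simp: T_def) linarith+
    have log: "0 \<le> log 2 k" using k by simp
    have "real k = 2 powr log 2 k" using k by simp
    also have "\<dots> \<le> 2 powr real (nat \<lceil>log 2 k\<rceil>)" by (intro powr_mono) (auto simp: real_nat_ceiling_ge)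
    also have "\<dots> = real (2 ^ nat \<lceil>log 2 k\<rceil>)" by (simp add: powr_realpow)
    finally have "k \<le> 2 ^ nat \<lceil>log 2 k\<rceil>" by (simp only: of_nat_le_iff)
    then have "k ^ 3 \<le> (2 ^ nat \<lceil>log 2 k\<rceil>) ^ 3" by (rule power_mono) simp
    then have "2 ^ 17 * k ^ 3 \<le> 2 ^ 17 * (2 ^ nat \<lceil>log 2 k\<rceil>) ^ 3" by (rule mult_left_mono) simp
    also have "\<dots> = 2 ^ d" by (simp only: d_def power_add power_mult mult.commute[of 3])
    finally have d: "2 ^ 17 * k ^ 3 \<le> 2 ^ d" .
    have "log 2 k \<le> 2 * ln x"
    proof -
      have "1 / 2 \<le> ln (2::real)" using ln_le_minus_one[of "1 / 2 :: real"] by (simp add: ln_div)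
      then have "ln k * 1 \<le> ln k * (2 * ln 2)" using k by (intro mult_left_mono) auto
      then have "log 2 k \<le> 2 * ln k" by (simp add: log_def field_simps)
      also have "ln k \<le> ln x" using x k by (subst ln_le_cancel_iff) auto
      finally show ?thesis by simp
    qed
    \<comment> \<open>Rounding up gives \<open>19 + 3 * (log 2 k + 1)\<close>, at most
      \<open>22 + 6 * ln x\<close>.\<close>
    then have "real (d + 2) \<le> 22 * (1 + ln x)"
      using log x by (simp add: d_def) (smt (verit) ceiling_correct ln_ge_zero)
    then have "real (T * (d + 2)) \<le> 289 * x * (22 * (1 + ln x))"
      unfolding of_nat_mult using T(2) x by (intro mult_mono) auto
    also have "\<dots> = 289 * 22 * (x * (1 + ln x))" by simp
    also have "\<dots> \<le> 289 * 22 * 9 * max 1 (x * ln x)" using query_count_bound[OF x(1)] by simp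
    finally have bound: "real (T * (d + 2)) \<le> 289 * 22 * 9 * max 1 (x * ln x)" .
    have "288 * k \<le> \<epsilon> * T"
      using T(1) \<epsilon> by (simp add: x_def field_simps)
    moreover have "10 * k < n" using k(2) by linarith
    ultimately obtain A :: "qtree pmf" where A: "\<forall>t\<in>set_pmf A. queries_in n t \<and> depth t \<le> T * (d + 2)"
      "\<forall>f. t_symmetric n (n - k) f \<longrightarrow> measure_pmf.prob A {t. run f t} \<ge> 2/3"
      "\<forall>f. far_from_t_symmetric n (n - k) \<epsilon> f \<longrightarrow> measure_pmf.prob A {t. \<not> run f t} \<ge> 2/3"
      using tester_pmf[OF k(1) _ \<epsilon> True d] by blast
    have "real (depth t) \<le> 289 * 22 * 9 * max 1 (x * ln x)" if "t \<in> set_pmf A" for t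
      using A(1) that bound by (meson of_nat_le_iff order_trans)
    then show ?thesis using A unfolding x_def by blast
  qed
qed simp

end
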